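(* Let $s\in(1,2]$ and let $K\subseteq[0,1]$ be a compact set. If $f\in H_s(K)$ is a regular full-dimensional function, then there exists a compact subset $F\subseteq K$ such that (1) $\dim_H F=s-1$, and (2) $f$ is Lipschitz on $F$.
   Context: For compact $K\subseteq[0,1]$, $C(K)$ is the space of real-valued continuous functions on $K$, $G_f(X)=\{(x,f(x)):x\in X\}$, $\dim_H$ is Hausdorff dimension, $H_s(K)=\{f\in C(K):\dim_H G_f(K)=s\}$, and $B(x,r)$ is the open ball of center $x$ and radius $r$. For $f\in C(K)$, $x_0\in K$ and $\beta\in(0,+\infty)$, set $V_\beta=\{(x,y)\in\mathbb{R}^2: x\neq x_0,\ |(y-f(x_0))/(x-x_0)|\leq\beta\}$. The point $x_0$ is a $\beta$-regular full-dimensional point of $f$ if $\dim_H\big(V_\beta\cap G_f(K\cap B(x_0,r))\big)=\dim_H G_f(K)$ for every $r>0$. The function $f$ is regular full-dimensional if for some $\beta\in(0,+\infty)$ it has a $\beta$-regular full-dimensional point. *)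

theory Defs
  imports "HOL-Analysis.Analysis"
begin

definition hsize :: "real \<Rightarrow> 'a::metric_space set \<Rightarrow> real" where
  "hsize s U = (if U = {} then 0 else if s = 0 then 1 else diameter U powr s)"

text \<open>delta-approximating Hausdorff outer measure, using countable covers
  (finite covers are included by padding with empty sets) by bounded sets of
  diameter at most delta.\<close>
definition hausdorff_pre :: "real \<Rightarrow> real \<Rightarrow> 'a::metric_space set \<Rightarrow> ennreal" where
  "hausdorff_pre s \<delta> A =
     (INF C \<in> {C :: nat \<Rightarrow> 'a set. A \<subseteq> (\<Union>i. C i) \<and>
                  (\<forall>i. bounded (C i) \<and> diameter (C i) \<le> \<delta>)}.
        (\<Sum>i. ennreal (hsize s (C i))))"

definition hausdorff_measure :: "real \<Rightarrow> 'a::metric_space set \<Rightarrow> ennreal" where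
  "hausdorff_measure s A = (SUP \<delta> \<in> {0<..}. hausdorff_pre s \<delta> A)"

definition hausdorff_dim :: "'a::metric_space set \<Rightarrow> real" where
  "hausdorff_dim A = Inf {s. s \<ge> 0 \<and> hausdorff_measure s A = 0}"

definition graph :: "(real \<Rightarrow> real) \<Rightarrow> real set \<Rightarrow> (real \<times> real) set" where
  "graph f X = {(x, f x) | x. x \<in> X}"

definition cone_V :: "(real \<Rightarrow> real) \<Rightarrow> real \<Rightarrow> real \<Rightarrow> (real \<times> real) set" where
  "cone_V f x0 \<beta> = {(x, y). x \<noteq> x0 \<and> \<bar>(y - f x0) / (x - x0)\<bar> \<le> \<beta>}"

definition regular_fd_point :: "real set \<Rightarrow> (real \<Rightarrow> real) \<Rightarrow> real \<Rightarrow> real \<Rightarrow> bool" where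
  "regular_fd_point K f \<beta> x0 \<longleftrightarrow> x0 \<in> K \<and>
     (\<forall>r>0. hausdorff_dim (cone_V f x0 \<beta> \<inter> graph f (K \<inter> ball x0 r))
            = hausdorff_dim (graph f K))"

definition regular_full_dimensional :: "real set \<Rightarrow> (real \<Rightarrow> real) \<Rightarrow> bool" where
  "regular_full_dimensional K f \<longleftrightarrow> (\<exists>\<beta>>0. \<exists>x0. regular_fd_point K f \<beta> x0)"

end

theory Submission
  imports Defs
begin

text \<open>A set of dimension greater than \<open>t > 1\<close> has, for some slope in \<open>[0, 1]\<close>, a set of positive measure of lines
  meeting it in dimension greater than any \<open>u < t - 1\<close>, while almost every line of a given slope meets it in dimension
  at most \<open>s - 1\<close> if the set has dimension \<open>s\<close>. On the projection of such a section of the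
  graph \<open>f\<close> is affine, hence Lipschitz. Take such sections inside the cone at the regular point \<open>x0\<close>, in
  annuli shrinking to \<open>x0\<close> geometrically, of dimensions tending to \<open>s - 1\<close>. Their union
  together with \<open>x0\<close> is compact of dimension \<open>s - 1\<close>, and the cone condition makes \<open>f\<close>
  Lipschitz across different annuli.

  The lower bound on sections replaces Frostman's measure by finitely many weighted points at one
  dyadic scale, whose slices have bounded energy on average over the slope because
  two points at distance \<open>d\<close> are projected within \<open>\<delta>\<close> of each other by a set of slopes of measure
  \<open>O(\<delta> / d)\<close>.\<close>

section \<open>Hausdorff null sets\<close>

text \<open>With cell budgets \<open>2 powr - t\<close> per level, the averaged energy is controlled
  by geometric series of ratios \<open>2 powr (1 - t)\<close> and
  \<open>2 powr (u + (1 - t))\<close>. Convergence uses the strict gap \<open>u < t - 1\<close>, so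
  a single section reaches exponents below \<open>s - 1\<close> but not \<open>s - 1\<close> itself.
  Hence infinitely many pieces are joined, and since a union of Lipschitz pieces need not be
  Lipschitz, they must be joined at a point where \<open>f\<close> is controlled.

  No limit measure is formed: the contradiction takes place at one scale \<open>2^-n\<close>. This
  is possible because the content bound \<kappa>, the energy bound \<open>C\<close> and the
  thresholds \<epsilon>, \<eta> are fixed before \<open>n\<close>. A suitable \<open>n\<close>
  exists by compactness: a finite cheap cover of a null section also covers a thin tube around the
  line, so the sets of bad lines decrease to a null set.

  Nullity on either side of the exponent is carried along instead of the dimension, because it
  passes directly through countable unions and Lipschitz images.\<close>

text \<open>For \<open>s > 0\<close> smallness of the sum already forces smallness of the diameters, so no bound
  \<open>\<delta>\<close> on them is needed.\<close>
definition hnull :: "real \<Rightarrow> 'a::metric_space set \<Rightarrow> bool" where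
  "hnull s A \<longleftrightarrow> (\<forall>\<epsilon>>0. \<exists>C::nat \<Rightarrow> 'a set. A \<subseteq> (\<Union>i. C i) \<and> (\<forall>i. bounded (C i)) \<and>
     (\<Sum>i. ennreal (diameter (C i) powr s)) < ennreal \<epsilon>)"

lemma hnullE:
  assumes "hnull s A" "\<epsilon> > 0"
  obtains C :: "nat \<Rightarrow> 'a::metric_space set" where "A \<subseteq> (\<Union>i. C i)" "\<And>i. bounded (C i)"
    "(\<Sum>i. ennreal (diameter (C i) powr s)) < ennreal \<epsilon>"
  using assms unfolding hnull_def by blast

lemma ennreal_term_less_of_suminf_less:
  assumes "(\<Sum>i. ennreal (a i)) < ennreal \<epsilon>" "\<And>i. 0 \<le> a i"
  shows "a i < \<epsilon>"
proof -
  have "ennreal (a i) \<le> (\<Sum>i. ennreal (a i))"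
    using sum_le_suminf[of "\<lambda>i. ennreal (a i)" "{i}"] by simp
  then show ?thesis
    using assms by (metis ennreal_less_iff order_le_less_trans)
qed

lemma hsize_eq_powr: "s > 0 \<Longrightarrow> hsize s U = diameter U powr s"
  by (simp add: hsize_def)

lemma hausdorff_measure_eq_0_iff_hnull:
  fixes A :: "'a::metric_space set"
  assumes s: "s > 0"
  shows "hausdorff_measure s A = 0 \<longleftrightarrow> hnull s A"
proof
  assume H: "hausdorff_measure s A = 0"
  show "hnull s A" unfolding hnull_def
  proof (intro allI impI)
    fix \<epsilon> :: real assume e: "\<epsilon> > 0"
    have "hausdorff_pre s 1 A \<le> hausdorff_measure s A"
      unfolding hausdorff_measure_def by (rule SUP_upper) simp
    with H e have "hausdorff_pre s 1 A < ennreal \<epsilon>" by simp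
    then show "\<exists>C::nat \<Rightarrow> 'a set. A \<subseteq> (\<Union>i. C i) \<and> (\<forall>i. bounded (C i)) \<and>
        (\<Sum>i. ennreal (diameter (C i) powr s)) < ennreal \<epsilon>"
      unfolding hausdorff_pre_def INF_less_iff hsize_eq_powr[OF s] by blast
  qed
next
  assume N: "hnull s A"
  have "hausdorff_pre s \<delta> A = 0" if d: "\<delta> > 0" for \<delta>
  proof -
    have "hausdorff_pre s \<delta> A \<le> ennreal \<epsilon>" if e: "\<epsilon> > 0" for \<epsilon>
    proof -
      have "min \<epsilon> (\<delta> powr s) > 0" using d e by simp
      then obtain C where C: "A \<subseteq> (\<Union>i. C i)" "\<And>i. bounded (C i)"
          "(\<Sum>i. ennreal (diameter (C i) powr s)) < ennreal (min \<epsilon> (\<delta> powr s))"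
        using hnullE[OF N] by metis
      have "diameter (C i) \<le> \<delta>" for i
      proof -
        have "diameter (C i) powr s < \<delta> powr s"
          using ennreal_term_less_of_suminf_less[OF C(3), of i] by simp
        then show ?thesis
          using powr_mono2[of s \<delta> "diameter (C i)"] s d by (meson less_imp_le not_le)
      qed
      then have "hausdorff_pre s \<delta> A \<le> (\<Sum>i. ennreal (hsize s (C i)))"
        unfolding hausdorff_pre_def using C by (intro INF_lower) auto
      also have "\<dots> \<le> ennreal (min \<epsilon> (\<delta> powr s))"
        using C(3) by (simp add: hsize_eq_powr[OF s])
      also have "\<dots> \<le> ennreal \<epsilon>" by (rule ennreal_leI) simp
      finally show ?thesis .
    qed
    then show ?thesis
      by (metis ennreal_le_epsilon ennreal_zero_less_top add_0 le_zero_eq)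
  qed
  then show "hausdorff_measure s A = 0" unfolding hausdorff_measure_def by simp
qed

lemma hnull_subset: "hnull s B \<Longrightarrow> A \<subseteq> B \<Longrightarrow> hnull s A"
  unfolding hnull_def by (meson subset_trans)

lemma hnull_mono_exponent:
  assumes N: "hnull s A" and st: "0 < s" "s \<le> t"
  shows "hnull t A"
  unfolding hnull_def
proof (intro allI impI)
  fix \<epsilon> :: real assume e: "\<epsilon> > 0"
  then have "min \<epsilon> 1 > 0" by simp
  then obtain C where C: "A \<subseteq> (\<Union>i. C i)" "\<And>i. bounded (C i)"
      "(\<Sum>i. ennreal (diameter (C i) powr s)) < ennreal (min \<epsilon> 1)"
    using hnullE[OF N] by metis
  have "diameter (C i) powr t \<le> diameter (C i) powr s" for i
  proof -
    have "diameter (C i) powr s < 1"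
      using ennreal_term_less_of_suminf_less[OF C(3), of i] by simp
    then have "diameter (C i) \<le> 1"
      using powr_mono2[of s 1 "diameter (C i)"] st by (metis less_imp_le linorder_not_le powr_one_eq_one zero_le_one)
    then show ?thesis using st diameter_ge_0[OF C(2)] by (intro powr_mono') auto
  qed
  then have "(\<Sum>i. ennreal (diameter (C i) powr t)) \<le> (\<Sum>i. ennreal (diameter (C i) powr s))"
    by (intro suminf_le) (auto intro: ennreal_leI)
  also have "\<dots> < ennreal (min \<epsilon> 1)" by (rule C)
  also have "\<dots> \<le> ennreal \<epsilon>" by (rule ennreal_leI) simp
  finally show "\<exists>C. A \<subseteq> (\<Union>i. C i) \<and> (\<forall>i. bounded (C i)) \<and> (\<Sum>i. ennreal (diameter (C i) powr t)) < ennreal \<epsilon>"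
    using C by blast
qed

lemma hnull_UN:
  fixes A :: "nat \<Rightarrow> 'a::metric_space set"
  assumes N: "\<And>n. hnull s (A n)"
  shows "hnull s (\<Union>n. A n)"
  unfolding hnull_def
proof (intro allI impI)
  fix \<epsilon> :: real assume e: "\<epsilon> > 0"
  \<comment> \<open>Half of \<epsilon> is kept back: summing the strict bounds yields only
    \<open>\<le>\<close>, whereas \<open>hnull\<close> asks for \<open><\<close>.\<close>
  have "\<exists>C. A n \<subseteq> (\<Union>i. C i) \<and> (\<forall>i. bounded (C i)) \<and>
      (\<Sum>i. ennreal (diameter (C i) powr s)) < ennreal (\<epsilon>/2 * (1/2)^Suc n)" for n
    using N[of n] e unfolding hnull_def by simp
  then obtain C :: "nat \<Rightarrow> nat \<Rightarrow> 'a set" where C: "\<And>n. A n \<subseteq> (\<Union>i. C n i)" "\<And>n i. bounded (C n i)"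
      "\<And>n. (\<Sum>i. ennreal (diameter (C n i) powr s)) < ennreal (\<epsilon>/2 * (1/2)^Suc n)"
    by metis
  define D where "D = (\<lambda>k. case prod_decode k of (n, i) \<Rightarrow> C n i)"
  have "(\<Union>n. A n) \<subseteq> (\<Union>k. D k)"
  proof
    fix x assume "x \<in> (\<Union>n. A n)"
    then obtain n i where "x \<in> C n i" using C(1) by blast
    then have "x \<in> D (prod_encode (n, i))" by (simp add: D_def)
    then show "x \<in> (\<Union>k. D k)" by blast
  qed
  moreover have "bounded (D k)" for k by (simp add: D_def C split: prod.split)
  moreover have "(\<Sum>k. ennreal (diameter (D k) powr s)) < ennreal \<epsilon>"
  proof -
    have "(\<Sum>k. ennreal (diameter (D k) powr s)) =
        (\<Sum>k. (\<lambda>(n, i). ennreal (diameter (C n i) powr s)) (prod_decode k))"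
      by (rule suminf_cong) (simp add: D_def split: prod.split)
    also have "\<dots> = (\<Sum>n. \<Sum>i. ennreal (diameter (C n i) powr s))"
      by (subst suminf_ennreal_2dimen[where f = "\<lambda>(n, i). ennreal (diameter (C n i) powr s)" and
            g = "\<lambda>n. \<Sum>i. ennreal (diameter (C n i) powr s)"]) (simp_all add: comp_def)
    also have "\<dots> \<le> (\<Sum>n. ennreal (\<epsilon>/2 * (1/2)^Suc n))"
      using C(3) by (intro suminf_le) (auto intro: less_imp_le)
    also have "\<dots> = ennreal (\<epsilon>/2)"
      using e power_half_series sums_mult[OF power_half_series, of "\<epsilon>/2"]
      by (intro suminf_ennreal_eq) auto
    also have "\<dots> < ennreal \<epsilon>" using e by (simp add: ennreal_less_iff)
    finally show ?thesis .
  qed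
  ultimately show "\<exists>C. (\<Union>n. A n) \<subseteq> (\<Union>i. C i) \<and> (\<forall>i. bounded (C i)) \<and>
      (\<Sum>i. ennreal (diameter (C i) powr s)) < ennreal \<epsilon>" by blast
qed

lemma hnull_empty: "hnull s {}"
  unfolding hnull_def by (intro allI impI exI[of _ "\<lambda>_. {}"]) auto

lemma hnull_lipschitz_image:
  fixes g :: "'a::metric_space \<Rightarrow> 'b::metric_space"
  assumes N: "hnull s A" and L: "L-lipschitz_on A g" and s: "s > 0"
  shows "hnull s (g ` A)"
  unfolding hnull_def
proof (intro allI impI)
  fix \<epsilon> :: real assume e: "\<epsilon> > 0"
  \<comment> \<open>\<open>L\<close> may be 0, and the budget below is divided by a power of the
    constant.\<close>
  define M where "M = L + 1"
  have M: "M > 0" "M-lipschitz_on A g"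
    using L lipschitz_on_nonneg[OF L] by (auto simp: M_def intro: lipschitz_on_le)
  have "\<epsilon> / M powr s > 0" using e M by simp
  then obtain C where C: "A \<subseteq> (\<Union>i. C i)" "\<And>i. bounded (C i)"
      "(\<Sum>i. ennreal (diameter (C i) powr s)) < ennreal (\<epsilon> / M powr s)"
    using hnullE[OF N] by metis
  \<comment> \<open>The sets are cut back to \<open>A\<close>, since \<open>g\<close> is controlled
    only there.\<close>
  define D where "D i = g ` (C i \<inter> A)" for i
  have dist: "dist x y \<le> M * diameter (C i)" if xy: "x \<in> D i" "y \<in> D i" for i x y
  proof -
    obtain a b where ab: "a \<in> C i" "b \<in> C i" "a \<in> A" "b \<in> A" "x = g a" "y = g b"
      using xy unfolding D_def by blast
    then have "dist x y \<le> M * dist a b" using lipschitz_onD[OF M(2)] by blast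
    also have "\<dots> \<le> M * diameter (C i)"
      using diameter_bounded_bound[OF C(2) ab(1,2)] M by (intro mult_left_mono) auto
    finally show ?thesis .
  qed
  have bD: "bounded (D i)" for i
    unfolding bounded_two_points using dist by blast
  have dD: "diameter (D i) \<le> M * diameter (C i)" for i
  proof (cases "D i = {}")
    case True
    then show ?thesis using M(1) diameter_ge_0[OF C(2), of i] by simp
  next
    case False
    then have "(SUP (x, y)\<in>D i \<times> D i. dist x y) \<le> M * diameter (C i)"
      using dist[of _ i] by (intro cSUP_least) auto
    then show ?thesis using False by (simp add: diameter_def)
  qed
  have "(\<Sum>i. ennreal (diameter (D i) powr s)) \<le> (\<Sum>i. ennreal (M powr s) * ennreal (diameter (C i) powr s))"
  proof (rule suminf_le)
    fix i
    have "diameter (D i) powr s \<le> (M * diameter (C i)) powr s"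
      using dD s diameter_ge_0[OF bD] by (intro powr_mono2) auto
    also have "\<dots> = M powr s * diameter (C i) powr s"
      using M diameter_ge_0[OF C(2)] by (simp add: powr_mult)
    finally show "ennreal (diameter (D i) powr s) \<le> ennreal (M powr s) * ennreal (diameter (C i) powr s)"
      by (simp add: ennreal_mult[symmetric] ennreal_leI)
  qed auto
  also have "\<dots> = ennreal (M powr s) * (\<Sum>i. ennreal (diameter (C i) powr s))"
    by simp
  also have "\<dots> < ennreal (M powr s) * ennreal (\<epsilon> / M powr s)"
    using C(3) M by (intro ennreal_mult_strict_left_mono) auto
  also have "\<dots> = ennreal \<epsilon>" using M e by (simp add: ennreal_mult[symmetric])
  finally have "(\<Sum>i. ennreal (diameter (D i) powr s)) < ennreal \<epsilon>" .
  moreover have "g ` A \<subseteq> (\<Union>i. D i)" using C(1) unfolding D_def by blast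
  ultimately show "\<exists>C. g ` A \<subseteq> (\<Union>i. C i) \<and> (\<forall>i. bounded (C i)) \<and>
      (\<Sum>i. ennreal (diameter (C i) powr s)) < ennreal \<epsilon>"
    using bD by blast
qed

text \<open>The index type is left free so that a finite family of dyadic cells can serve as its own
  index set.\<close>

lemma hnull_of_finite_covers:
  fixes A :: "'a::metric_space set"
  assumes "s > 0"
    "\<And>\<epsilon>. \<epsilon> > 0 \<Longrightarrow> \<exists>I (C::'i \<Rightarrow> 'a set). finite I \<and> A \<subseteq> (\<Union>i\<in>I. C i) \<and> (\<forall>i\<in>I. bounded (C i)) \<and> (\<Sum>i\<in>I. diameter (C i) powr s) < \<epsilon>"
  shows "hnull s A"
  unfolding hnull_def
proof (intro allI impI)
  fix \<epsilon> :: real assume e: "\<epsilon> > 0"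
  from assms(2)[OF this] obtain I and C :: "'i \<Rightarrow> 'a set" where C: "finite I" "A \<subseteq> (\<Union>i\<in>I. C i)"
    "\<forall>i\<in>I. bounded (C i)" "(\<Sum>i\<in>I. diameter (C i) powr s) < \<epsilon>" by blast
  obtain h where h: "bij_betw h {0..<card I} I" using ex_bij_betw_nat_finite[OF C(1)] by blast
  define D where "D n = (if n < card I then C (h n) else {})" for n
  have "A \<subseteq> (\<Union>n. D n)"
  proof
    fix x assume "x \<in> A"
    then obtain i where i: "i \<in> I" "x \<in> C i" using C by blast
    have "i \<in> h ` {0..<card I}" using i h by (simp add: bij_betw_def)
    then obtain n where "n < card I" "i = h n" by auto
    then show "x \<in> (\<Union>n. D n)" using i by (auto simp: D_def)
  qed
  moreover have "bounded (D n)" for n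
    using C(3) h by (auto simp: D_def bij_betw_def)
  moreover have "(\<Sum>n. ennreal (diameter (D n) powr s)) < ennreal \<epsilon>"
  proof -
    have "(\<Sum>n. ennreal (diameter (D n) powr s)) = (\<Sum>n\<in>{0..<card I}. ennreal (diameter (D n) powr s))"
      using assms(1) by (intro suminf_finite) (auto simp: D_def)
    also have "\<dots> = (\<Sum>n\<in>{0..<card I}. ennreal (diameter (C (h n)) powr s))"
      by (rule sum.cong) (auto simp: D_def)
    also have "\<dots> = (\<Sum>i\<in>I. ennreal (diameter (C i) powr s))"
      by (rule sum.reindex_bij_betw[OF h])
    also have "\<dots> = ennreal (\<Sum>i\<in>I. diameter (C i) powr s)" by simp
    also have "\<dots> < ennreal \<epsilon>" using C(4) e by (simp add: ennreal_less_iff sum_nonneg)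
    finally show ?thesis .
  qed
  ultimately show "\<exists>C. A \<subseteq> (\<Union>i. C i) \<and> (\<forall>i. bounded (C i)) \<and>
      (\<Sum>i. ennreal (diameter (C i) powr s)) < ennreal \<epsilon>" by blast
qed

section \<open>Sections by lines\<close>

text \<open>The intercept of the line of slope \<open>m\<close> through \<open>p\<close>. In slope
  and intercept coordinates vertical lines do not occur, so \<open>f\<close> is affine on the
  projection of every section of its graph.\<close>

definition proj :: "real \<Rightarrow> real \<times> real \<Rightarrow> real" where
  "proj m p = snd p - m * fst p"

definition line :: "real \<Rightarrow> real \<Rightarrow> (real \<times> real) set" where
  "line m c = {p. proj m p = c}"

lemma abs_proj_diff_le:
  assumes "m \<in> {0..1}"
  shows "\<bar>proj m p - proj m q\<bar> \<le> 2 * dist p q"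
proof -
  have "\<bar>proj m p - proj m q\<bar> = \<bar>(snd p - snd q) - m * (fst p - fst q)\<bar>"
    by (simp add: proj_def algebra_simps)
  also have "\<dots> \<le> \<bar>snd p - snd q\<bar> + m * \<bar>fst p - fst q\<bar>"
    using assms abs_triangle_ineq4[of "snd p - snd q" "m * (fst p - fst q)"] by (simp add: abs_mult)
  also have "\<dots> \<le> dist p q + 1 * dist p q"
    using assms dist_fst_le[of p q] dist_snd_le[of p q] by (intro add_mono mult_mono) (auto simp: dist_real_def)
  finally show ?thesis by simp
qed

text \<open>Integrating \<open>\<Sum>i. diameter (C i) powr (v - 1)\<close>, taken over the cover elements met by the line,
  over all intercepts costs one further factor \<open>diameter (C i)\<close>.\<close>
lemma AE_hnull_line_section:
  fixes A :: "(real \<times> real) set"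
  assumes N: "hnull v A" and v: "v > 1" and m: "m \<in> {0..1}"
  shows "AE c in lborel. hnull (v - 1) (A \<inter> line m c)"
proof -
  \<comment> \<open>The budgets are summable in \<open>j\<close>, so the integrals of the
    \<open>g j\<close> below have a finite sum. For almost every intercept the series of the
    \<open>g j\<close> then converges, and some term falls below any given \<epsilon>.\<close>
  have "\<exists>C. A \<subseteq> (\<Union>i. C i) \<and> (\<forall>i. bounded (C i)) \<and>
      (\<Sum>i. ennreal (diameter (C i) powr v)) < ennreal ((1/2)^Suc j)" for j
    using N unfolding hnull_def by simp
  then obtain C :: "nat \<Rightarrow> nat \<Rightarrow> (real \<times> real) set" where C: "\<And>j. A \<subseteq> (\<Union>i. C j i)" "\<And>j i. bounded (C j i)"
      "\<And>j. (\<Sum>i. ennreal (diameter (C j i) powr v)) < ennreal ((1/2)^Suc j)"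
    by metis
  \<comment> \<open>For an empty set the chosen point is arbitrary, which is harmless: the diameter
    is 0 and \<open>I j i\<close> is a single point.\<close>
  define pt where "pt j i = (SOME p. p \<in> C j i)" for j i
  define I where "I j i = {proj m (pt j i) - 2 * diameter (C j i) ..
      proj m (pt j i) + 2 * diameter (C j i)}" for j i
  have I: "c \<in> I j i" if "p \<in> C j i" "p \<in> line m c" for p c j i
  proof -
    have "pt j i \<in> C j i" unfolding pt_def using that(1) by (rule someI)
    then have "dist p (pt j i) \<le> diameter (C j i)" using that C(2) by (intro diameter_bounded_bound)
    then show ?thesis using abs_proj_diff_le[OF m, of p "pt j i"] that(2) unfolding I_def line_def by auto
  qed
  define g where "g j c = (\<Sum>i. ennreal (diameter (C j i) powr (v - 1)) * indicator (I j i) c)" for j c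
  have gm[measurable]: "g j \<in> borel_measurable lborel" for j unfolding g_def I_def by measurable
  have "(\<integral>\<^sup>+c. g j c \<partial>lborel) \<le> ennreal (4 * (1/2)^Suc j)" for j
  proof -
    have "(\<integral>\<^sup>+c. g j c \<partial>lborel) = (\<Sum>i. \<integral>\<^sup>+c. ennreal (diameter (C j i) powr (v - 1)) * indicator (I j i) c \<partial>lborel)"
      unfolding g_def by (rule nn_integral_suminf) (simp add: I_def)
    also have "\<dots> = (\<Sum>i. ennreal 4 * ennreal (diameter (C j i) powr v))"
    proof (rule suminf_cong)
      fix i
      have d: "diameter (C j i) \<ge> 0" using C(2) by (rule diameter_ge_0)
      have "(\<integral>\<^sup>+c. ennreal (diameter (C j i) powr (v - 1)) * indicator (I j i) c \<partial>lborel)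
          = ennreal (diameter (C j i) powr (v - 1)) * ennreal (4 * diameter (C j i))"
        using d by (subst nn_integral_cmult_indicator) (auto simp: I_def)
      also have "\<dots> = ennreal (4 * (diameter (C j i) powr (v - 1) * diameter (C j i)))"
        using d by (simp add: ennreal_mult[symmetric] mult_ac)
      also have "diameter (C j i) powr (v - 1) * diameter (C j i) = diameter (C j i) powr v"
        using d v by (cases "diameter (C j i) = 0") (auto simp: powr_diff)
      finally show "(\<integral>\<^sup>+c. ennreal (diameter (C j i) powr (v - 1)) * indicator (I j i) c \<partial>lborel) =
          ennreal 4 * ennreal (diameter (C j i) powr v)" by (simp add: ennreal_mult)
    qed
    also have "\<dots> = ennreal 4 * (\<Sum>i. ennreal (diameter (C j i) powr v))" by (rule ennreal_suminf_cmult)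
    also have "\<dots> \<le> ennreal 4 * ennreal ((1/2)^Suc j)"
      using C(3)[of j] by (intro mult_left_mono) auto
    also have "\<dots> = ennreal (4 * (1/2)^Suc j)" by (rule ennreal_mult[symmetric]) auto
    finally show ?thesis .
  qed
  then have "(\<Sum>j. \<integral>\<^sup>+c. g j c \<partial>lborel) \<le> (\<Sum>j. ennreal (4 * (1/2)^Suc j))"
    by (intro suminf_le) auto
  also have "\<dots> = ennreal 4"
    using sums_mult[OF power_half_series, of 4] by (intro suminf_ennreal_eq) auto
  finally have "(\<Sum>j. \<integral>\<^sup>+c. g j c \<partial>lborel) \<noteq> \<infinity>" by (auto simp: top_unique)
  moreover have "(\<integral>\<^sup>+c. (\<Sum>j. g j c) \<partial>lborel) = (\<Sum>j. \<integral>\<^sup>+c. g j c \<partial>lborel)"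
    by (rule nn_integral_suminf) simp
  ultimately have "AE c in lborel. (\<Sum>j. g j c) \<noteq> \<infinity>"
    by (intro nn_integral_PInf_AE) auto
  then show ?thesis
  proof (rule AE_mp, intro AE_I2 impI)
    fix c assume fin: "(\<Sum>j. g j c) \<noteq> \<infinity>"
    show "hnull (v - 1) (A \<inter> line m c)"
      unfolding hnull_def
    proof (intro allI impI)
      fix \<epsilon> :: real assume e: "\<epsilon> > 0"
      have "\<exists>j. g j c < ennreal \<epsilon>"
      proof (rule ccontr)
        assume "\<not> ?thesis"
        then have "ennreal \<epsilon> \<le> g j c" for j by (meson not_le)
        then have "(\<Sum>j::nat. ennreal \<epsilon>) \<le> (\<Sum>j. g j c)" by (rule suminf_le[OF _ summableI summableI])
        then have "(\<Sum>j::nat. ennreal \<epsilon>) \<noteq> top"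
          using fin unfolding infinity_ennreal_def by (metis top_unique)
        then have "summable (\<lambda>j::nat. \<epsilon>)"
          using e by (intro summable_suminf_not_top) (auto intro: less_imp_le)
        then have "\<epsilon> = 0" by (simp only: summable_const_iff)
        then show False using e by simp
      qed
      then obtain j where j: "g j c < ennreal \<epsilon>" by blast
      define D where "D i = (if c \<in> I j i then C j i else {})" for i
      have "A \<inter> line m c \<subseteq> (\<Union>i. D i)"
        using C(1)[of j] I[of _ j _ c] by (fastforce simp: D_def)
      moreover have "(\<Sum>i. ennreal (diameter (D i) powr (v - 1))) = g j c"
        unfolding g_def using v by (intro suminf_cong) (auto simp: D_def)
      ultimately show "\<exists>D. A \<inter> line m c \<subseteq> (\<Union>i. D i) \<and> (\<forall>i. bounded (D i)) \<and>
          (\<Sum>i. ennreal (diameter (D i) powr (v - 1))) < ennreal \<epsilon>"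
        using j C(2) by (intro exI[of _ D]) (auto simp: D_def)
    qed
  qed
qed

section \<open>A discrete Frostman lemma\<close>

text \<open>The integer corner of the half-open dyadic square of side \<open>2^-k\<close> containing
  the point. Each level partitions the plane, and the levels are nested.\<close>

definition cell :: "nat \<Rightarrow> real \<times> real \<Rightarrow> int \<times> int" where
  "cell k p = (\<lfloor>2^k * fst p\<rfloor>, \<lfloor>2^k * snd p\<rfloor>)"

definition cell_cover :: "(nat \<times> int \<times> int) set \<Rightarrow> (real \<times> real) set \<Rightarrow> bool" where
  "cell_cover G S \<longleftrightarrow> (\<forall>p\<in>S. \<exists>(k, q)\<in>G. cell k p = q)"

text \<open>Dropping binary digits is integer division by a power of 2; this is the source of the
  nestedness of cells.\<close>

lemma floor_dyadic_coarsen: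
  assumes "k' \<le> k"
  shows "\<lfloor>2^k' * (z::real)\<rfloor> = \<lfloor>2^k * z\<rfloor> div 2^(k - k')"
proof -
  have "\<lfloor>2^k * z\<rfloor> div 2^(k - k') = \<lfloor>2^k * z / 2^(k - k')\<rfloor>"
    by (simp flip: floor_divide_real_eq_div)
  also have "2^k * z / 2^(k - k') = 2^k' * z"
    using assms by (simp add: power_diff field_simps flip: power_add)
  finally show ?thesis by simp
qed

lemma cell_coarsen: "cell k p = cell k q \<Longrightarrow> k' \<le> k \<Longrightarrow> cell k' p = cell k' q"
  unfolding cell_def by (simp add: floor_dyadic_coarsen)

lemma abs_less_of_floor_eq:
  assumes "\<lfloor>2^k * a\<rfloor> = \<lfloor>2^k * (b::real)\<rfloor>"
  shows "\<bar>a - b\<bar> < (1/2)^k"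
proof -
  have "\<bar>2^k * a - 2^k * b\<bar> < 1" using assms by linarith
  then have "2^k * \<bar>a - b\<bar> < 1" by (simp add: abs_mult right_diff_distrib[symmetric])
  then show ?thesis by (simp add: field_simps)
qed

lemma floor_diff_le_1:
  assumes "\<bar>a - b\<bar> \<le> (1/2)^k"
  shows "\<lfloor>2^k * a\<rfloor> - \<lfloor>2^k * (b::real)\<rfloor> \<in> {-1, 0, 1}"
proof -
  have "2^k * \<bar>a - b\<bar> \<le> 1" using assms by (simp add: field_simps)
  then have "\<bar>2^k * a - 2^k * b\<bar> \<le> 1" by (simp add: abs_mult right_diff_distrib[symmetric])
  then have "\<bar>\<lfloor>2^k * a\<rfloor> - \<lfloor>2^k * b\<rfloor>\<bar> \<le> 1" by linarith
  then show ?thesis by auto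
qed

lemma finite_cell_image:
  assumes "bounded A"
  shows "finite (cell k ` A)"
proof -
  obtain R where R: "\<And>p. p \<in> A \<Longrightarrow> norm p \<le> R" using assms bounded_iff by blast
  define M where "M = \<lceil>2^k * R\<rceil> + 1"
  have "cell k ` A \<subseteq> {-M..M} \<times> {-M..M}"
  proof (rule image_subsetI)
    fix p assume "p \<in> A"
    then have "\<bar>fst p\<bar> \<le> R" "\<bar>snd p\<bar> \<le> R"
      using R norm_fst_le[of "fst p" "snd p"] norm_snd_le[of "snd p" "fst p"] by fastforce+
    then have "2^k * \<bar>fst p\<bar> \<le> 2^k * R" "2^k * \<bar>snd p\<bar> \<le> 2^k * R" by auto
    then have "\<bar>2^k * fst p\<bar> \<le> 2^k * R" "\<bar>2^k * snd p\<bar> \<le> 2^k * R" by (auto simp: abs_mult)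
    then have "\<bar>\<lfloor>2^k * fst p\<rfloor>\<bar> \<le> M" "\<bar>\<lfloor>2^k * snd p\<rfloor>\<bar> \<le> M" unfolding M_def by linarith+
    then show "cell k p \<in> {-M..M} \<times> {-M..M}" unfolding cell_def by auto
  qed
  then show ?thesis by (rule finite_subset) auto
qed

text \<open>Greedy choice: each new point receives all the mass that the constraints still allow.\<close>
lemma maximal_cell_weights:
  fixes b :: "nat \<Rightarrow> real"
  assumes "finite T" "\<And>k. b k \<ge> 0"
  shows "\<exists>w. (\<forall>x. w x \<ge> 0) \<and> (\<forall>k\<le>N. \<forall>q. sum w {x\<in>T. cell k x = q} \<le> b k) \<and>
    (\<forall>x\<in>T. \<exists>k\<le>N. sum w {y\<in>T. cell k y = cell k x} = b k)"
  using assms(1)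
proof (induction T)
  case empty
  then show ?case using assms(2) by (auto intro: exI[of _ "\<lambda>_. 0"])
next
  case (insert z T)
  then obtain w where w: "\<And>x. w x \<ge> 0" "\<And>k q. k \<le> N \<Longrightarrow> sum w {x\<in>T. cell k x = q} \<le> b k"
    "\<And>x. x \<in> T \<Longrightarrow> \<exists>k\<le>N. sum w {y\<in>T. cell k y = cell k x} = b k" by blast
  define slack where "slack k = b k - sum w {x\<in>T. cell k x = cell k z}" for k
  \<comment> \<open>The tightest remaining constraint among the cells of \<open>z\<close>. The level
    attaining the minimum becomes saturated.\<close>
  define v where "v = Min (slack ` {..N})"
  define w' where "w' = w(z := v)"
  have v0: "v \<ge> 0" unfolding v_def slack_def using w(2) by (subst Min_ge_iff) auto
  have vle: "v \<le> slack k" if "k \<le> N" for k unfolding v_def using that by (intro Min_le) auto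
  have sumw': "sum w' {x\<in>insert z T. cell k x = q} = sum w {x\<in>T. cell k x = q} + (if q = cell k z then v else 0)" for k q
  proof -
    have fin: "finite {x\<in>T. cell k x = q}" using insert.hyps by simp
    have "sum w' {x\<in>T. cell k x = q} = sum w {x\<in>T. cell k x = q}"
      using insert.hyps by (intro sum.cong) (auto simp: w'_def)
    moreover have "{x\<in>insert z T. cell k x = q} = (if q = cell k z then insert z {x\<in>T. cell k x = q} else {x\<in>T. cell k x = q})"
      by auto
    ultimately show ?thesis using insert.hyps fin by (auto simp: w'_def)
  qed
  have bound: "sum w' {x\<in>insert z T. cell k x = q} \<le> b k" if "k \<le> N" for k q
    unfolding sumw' using w(2)[OF that, of q] vle[OF that] by (auto simp: slack_def)
  have "\<exists>k\<le>N. sum w' {y\<in>insert z T. cell k y = cell k x} = b k" if x: "x \<in> insert z T" for x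
  proof (cases "x = z")
    case True
    have "v \<in> slack ` {..N}" unfolding v_def by (intro Min_in) auto
    then obtain k where "k \<le> N" "v = slack k" by auto
    then show ?thesis unfolding sumw' True by (auto simp: slack_def)
  next
    case False
    then obtain k where k: "k \<le> N" "sum w {y\<in>T. cell k y = cell k x} = b k" using w(3) x by blast
    \<comment> \<open>Mass is only added, so a saturated cell could only overshoot, and
      \<open>bound\<close> forbids that.\<close>
    then have "b k \<le> sum w' {y\<in>insert z T. cell k y = cell k x}" unfolding sumw' using v0 by auto
    then show ?thesis using bound[OF k(1)] k(1) by (meson order_antisym)
  qed
  moreover have "w' x \<ge> 0" for x using w(1) v0 by (simp add: w'_def)
  ultimately show ?case using bound by blast
qed

text \<open>The coarsest saturated cells are disjoint and cover \<open>A\<close>, so their budgets \<open>b k\<close> add up to the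
  total mass.\<close>
lemma discrete_frostman:
  fixes A :: "(real \<times> real) set" and b :: "nat \<Rightarrow> real"
  assumes A: "bounded A" and b: "\<And>k. b k \<ge> 0"
    and cov: "\<And>G. finite G \<Longrightarrow> (\<forall>(k,q)\<in>G. k \<le> N) \<Longrightarrow> cell_cover G A \<Longrightarrow> \<kappa> \<le> (\<Sum>(k,q)\<in>G. b k)"
  obtains T w where "finite T" "T \<subseteq> A" "\<And>x. w x \<ge> (0::real)"
    "\<And>k q. k \<le> N \<Longrightarrow> sum w {x\<in>T. cell k x = q} \<le> b k" "\<kappa> \<le> sum w T"
proof -
  \<comment> \<open>One representative for each finest cell met by \<open>A\<close>: covers by cells
    of level at most \<open>N\<close> cannot tell \<open>T\<close> from \<open>A\<close>.\<close>
  obtain T where T: "T \<subseteq> A" "finite T" "cell N ` A = cell N ` T"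
    using finite_subset_image[OF finite_cell_image[OF A, of N] subset_refl] by metis
  obtain w where w: "\<And>x. w x \<ge> 0" "\<And>k q. k \<le> N \<Longrightarrow> sum w {x\<in>T. cell k x = q} \<le> b k"
    "\<And>x. x \<in> T \<Longrightarrow> \<exists>k\<le>N. sum w {y\<in>T. cell k y = cell k x} = b k"
    using maximal_cell_weights[OF T(2), of b N] b by blast
  define sat where "sat x k \<longleftrightarrow> k \<le> N \<and> sum w {y\<in>T. cell k y = cell k x} = b k" for x k
  define lev where "lev x = (LEAST k. sat x k)" for x
  have lev: "sat x (lev x)" if "x \<in> T" for x
    using w(3)[OF that] unfolding lev_def sat_def by (rule LeastI_ex)
  have lev_le: "lev x \<le> k" if "sat x k" for x k unfolding lev_def using that by (rule Least_le)
  define top where "top x = (lev x, cell (lev x) x)" for x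
  \<comment> \<open>Saturation of a cell does not depend on the point naming it, so for two points
    sharing a cell of this kind neither coarsest saturated cell can be strictly larger than the
    other.\<close>
  have top_eq: "top y = top x" if xy: "x \<in> T" "y \<in> T" "cell (lev x) y = cell (lev x) x" for x y
  proof -
    have "sat y (lev x)" using lev[OF xy(1)] xy(3) by (simp add: sat_def)
    then have le: "lev y \<le> lev x" by (rule lev_le)
    then have "cell (lev y) y = cell (lev y) x" using cell_coarsen[OF xy(3)] by blast
    then have "sat x (lev y)" using lev[OF xy(2)] by (simp add: sat_def)
    then have "lev x \<le> lev y" by (rule lev_le)
    then show ?thesis using le xy(3) by (simp add: top_def)
  qed
  have "\<kappa> \<le> (\<Sum>(k,q)\<in>top ` T. b k)"
  proof (rule cov)
    show "\<forall>(k,q)\<in>top ` T. k \<le> N" using lev by (auto simp: top_def sat_def)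
    show "cell_cover (top ` T) A"
      unfolding cell_cover_def
    proof
      fix p assume "p \<in> A"
      then obtain x where x: "x \<in> T" "cell N p = cell N x" using T(3) by (metis imageE imageI)
      then have "cell (lev x) p = cell (lev x) x" using cell_coarsen lev[OF x(1)] by (metis sat_def)
      then show "\<exists>(k,q)\<in>top ` T. cell k p = q" using x(1) by (auto simp: top_def intro!: bexI[of _ x])
    qed
  qed (use T in auto)
  also have "\<dots> = (\<Sum>Q\<in>top ` T. sum w {x\<in>T. top x = Q})"
  proof (rule sum.cong[OF refl])
    fix Q assume "Q \<in> top ` T"
    then obtain x where x: "x \<in> T" "Q = top x" by blast
    have "{y\<in>T. top y = Q} = {y\<in>T. cell (lev x) y = cell (lev x) x}"
      using top_eq[OF x(1)] x(2) by (auto simp: top_def)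
    then show "(case Q of (k, q) \<Rightarrow> b k) = sum w {x\<in>T. top x = Q}"
      using lev[OF x(1)] x(2) by (simp add: sat_def top_def)
  qed
  also have "\<dots> = sum w T" by (rule sum.image_gen[OF T(2), symmetric])
  finally show thesis using that T(1,2) w(1,2) by blast
qed

section \<open>Energy averaged over slopes\<close>

text \<open>The maximum metric fits square cells: points of one cell are within its side length, and
  points within the side length lie in equal or adjacent cells.\<close>

definition sup_dist :: "real \<times> real \<Rightarrow> real \<times> real \<Rightarrow> real" where
  "sup_dist p q = max \<bar>fst p - fst q\<bar> \<bar>snd p - snd q\<bar>"

definition close_slopes :: "nat \<Rightarrow> real \<times> real \<Rightarrow> real \<times> real \<Rightarrow> real set" where
  "close_slopes n p q = {m \<in> {0..1}. \<bar>proj m p - proj m q\<bar> \<le> (1/2)^n}"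

lemma sets_close_slopes[measurable]: "close_slopes n p q \<in> sets borel"
  unfolding close_slopes_def proj_def by measurable

lemma emeasure_close_slopes_finite: "emeasure lborel (close_slopes n p q) < top"
proof -
  have "emeasure lborel (close_slopes n p q) \<le> emeasure lborel {0..1::real}"
    by (rule emeasure_mono) (auto simp: close_slopes_def)
  then show ?thesis by (simp add: order_le_less_trans)
qed

lemma measure_close_slopes_le_1: "measure lborel (close_slopes n p q) \<le> 1"
proof -
  have "measure lborel (close_slopes n p q) \<le> measure lborel {0..1::real}"
  proof (rule measure_mono_fmeasurable)
    show "close_slopes n p q \<subseteq> {0..1}" unfolding close_slopes_def by blast
  qed (auto intro!: fmeasurableI simp: emeasure_lborel_Icc_eq)
  then show ?thesis by simp
qed

text \<open>Transversality. The difference of projections is affine in \<open>m\<close> with slope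
  \<open>- z1\<close>. If \<open>z1\<close> is comparable to the distance, the set lies in an
  interval of length \<open>2 * \<delta> / \<bar>z1\<bar>\<close>. Otherwise the vertical part
  dominates for every slope in \<open>{0..1}\<close>, and the set is empty unless the distance is at
  most \<open>2 * \<delta>\<close>, where the trivial bound 1 suffices.\<close>

lemma measure_close_slopes_le:
  assumes d: "sup_dist p q > 0"
  shows "measure lborel (close_slopes n p q) \<le> 4 * (1/2)^n / sup_dist p q"
proof -
  define \<delta> where "\<delta> = (1/2::real)^n"
  have \<delta>: "\<delta> > 0" by (simp add: \<delta>_def)
  define z1 where "z1 = fst p - fst q"
  define z2 where "z2 = snd p - snd q"
  have D: "sup_dist p q = max \<bar>z1\<bar> \<bar>z2\<bar>" by (simp add: sup_dist_def z1_def z2_def)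
  have pr: "proj m p - proj m q = z2 - m * z1" for m
    by (simp add: proj_def z1_def z2_def algebra_simps)
  have C: "close_slopes n p q = {m \<in> {0..1}. \<bar>z2 - m * z1\<bar> \<le> \<delta>}"
    by (simp add: close_slopes_def pr \<delta>_def)
  have "measure lborel (close_slopes n p q) \<le> 4 * \<delta> / sup_dist p q"
  proof (cases "\<bar>z2\<bar> \<le> 2 * \<bar>z1\<bar>")
    case True
    then have z1: "\<bar>z1\<bar> > 0" using d D by auto
    define c where "c = z2 / z1"
    have "close_slopes n p q \<subseteq> {c - \<delta> / \<bar>z1\<bar> .. c + \<delta> / \<bar>z1\<bar>}"
    proof
      fix m assume "m \<in> close_slopes n p q"
      then have "\<bar>z2 - m * z1\<bar> \<le> \<delta>" by (simp add: C)
      moreover have "z2 - m * z1 = z1 * (c - m)" using z1 by (simp add: c_def field_simps)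
      ultimately have "\<bar>z1\<bar> * \<bar>c - m\<bar> \<le> \<delta>" by (simp add: abs_mult)
      then have "\<bar>c - m\<bar> \<le> \<delta> / \<bar>z1\<bar>" using z1 by (simp add: field_simps)
      then show "m \<in> {c - \<delta> / \<bar>z1\<bar> .. c + \<delta> / \<bar>z1\<bar>}" by (simp add: abs_le_iff)
    qed
    then have "measure lborel (close_slopes n p q) \<le> measure lborel {c - \<delta> / \<bar>z1\<bar> .. c + \<delta> / \<bar>z1\<bar>}"
      by (intro measure_mono_fmeasurable fmeasurableI) (auto simp: emeasure_lborel_Icc_eq)
    also have "\<dots> = 2 * \<delta> / \<bar>z1\<bar>" using z1 \<delta> by simp
    also have "\<dots> \<le> 4 * \<delta> / sup_dist p q"
    proof -
      have "sup_dist p q \<le> 2 * \<bar>z1\<bar>" using True D by auto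
      then have "\<delta> * sup_dist p q \<le> \<delta> * (2 * \<bar>z1\<bar>)" using \<delta> by (intro mult_left_mono) auto
      then show ?thesis using z1 d by (simp add: field_simps)
    qed
    finally show ?thesis .
  next
    case False
    then have D2: "sup_dist p q = \<bar>z2\<bar>" using D by auto
    show ?thesis
    proof (cases "close_slopes n p q = {}")
      case True
      then show ?thesis using \<delta> d by simp
    next
      case ne: False
      then obtain m where m: "0 \<le> m" "m \<le> 1" "\<bar>z2 - m * z1\<bar> \<le> \<delta>" by (auto simp: C)
      have "\<bar>m * z1\<bar> \<le> 1 * \<bar>z1\<bar>" unfolding abs_mult using m by (intro mult_right_mono) auto
      then have "\<bar>z2\<bar> \<le> 2 * \<delta>" using m(3) False by linarith
      then have "1 \<le> 4 * \<delta> / sup_dist p q" using d D2 \<delta> by (simp add: field_simps)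
      then show ?thesis using measure_close_slopes_le_1 order_trans by blast
    qed
  qed
  then show ?thesis by (simp add: \<delta>_def)
qed

text \<open>The left side behaves like the reciprocal distance, truncated at \<open>2^n\<close> so
  that coinciding points are allowed. One term of the sum, at the finest level up to
  \<open>n\<close> still above the distance, already dominates it. The sum form replaces the kernel
  by balls, whose masses are bounded.\<close>

lemma kernel_le_dyadic_sum:
  assumes d: "sup_dist p q \<le> (1/2)^k" and kn: "k \<le> n"
  shows "2^n * measure lborel (close_slopes n p q) \<le> 8 * (\<Sum>i\<in>{k..n}. if sup_dist p q \<le> (1/2)^i then 2^i else 0)"
proof -
  define S where "S = {i\<in>{k..n}. sup_dist p q \<le> (1/2)^i}"
  define i where "i = Max S"
  have S: "finite S" "k \<in> S" using d kn by (auto simp: S_def)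
  then have iS: "i \<in> S" unfolding i_def by (intro Max_in) auto
  have "2^n * measure lborel (close_slopes n p q) \<le> 8 * 2^i"
  proof (cases "i = n")
    case True
    have "2^n * measure lborel (close_slopes n p q) \<le> 2^n * 1"
      using measure_close_slopes_le_1 by (intro mult_left_mono) auto
    also have "\<dots> \<le> 8 * 2^i" using True by simp
    finally show ?thesis .
  next
    case False
    have "Suc i \<notin> S" using Max_ge[OF S(1), of "Suc i"] i_def by auto
    then have gt: "sup_dist p q > (1/2)^Suc i" using False iS by (auto simp: S_def)
    have "(1/2::real)^Suc i > 0" by simp
    then have pos: "sup_dist p q > 0" using gt by linarith
    have "2^n * measure lborel (close_slopes n p q) \<le> 2^n * (4 * (1/2)^n / sup_dist p q)"
      using measure_close_slopes_le[OF pos] by (intro mult_left_mono) auto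
    also have "\<dots> = 4 / sup_dist p q" by (simp add: power_divide)
    also have "\<dots> \<le> 4 / (1/2)^Suc i" using gt by (intro divide_left_mono) (auto simp: pos)
    also have "\<dots> = 8 * 2^i" by (simp add: power_divide)
    finally show ?thesis .
  qed
  also have "2^i \<le> (\<Sum>i\<in>{k..n}. if sup_dist p q \<le> (1/2)^i then 2^i else (0::real))"
  proof -
    have "(2::real)^i = (if sup_dist p q \<le> (1/2)^i then 2^i else 0)" using iS by (simp add: S_def)
    also have "\<dots> \<le> (\<Sum>i\<in>{k..n}. if sup_dist p q \<le> (1/2)^i then 2^i else (0::real))"
      using iS by (intro member_le_sum) (auto simp: S_def)
    finally show ?thesis .
  qed
  finally show ?thesis by simp
qed

lemma sup_dist_le_of_cell_eq: "cell k p = cell k q \<Longrightarrow> sup_dist p q \<le> (1/2)^k"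
  unfolding cell_def sup_dist_def by (auto intro!: less_imp_le[OF abs_less_of_floor_eq])

definition block :: "int \<times> int \<Rightarrow> (int \<times> int) set" where
  "block q = (\<lambda>(i, j). (fst q + i, snd q + j)) ` ({-1, 0, 1} \<times> {-1, 0, 1})"

lemma finite_block: "finite (block q)" unfolding block_def by simp

lemma card_block_le: "card (block q) \<le> 9"
  unfolding block_def by (rule order_trans[OF card_image_le]) auto

lemma cell_in_block:
  assumes "sup_dist p q \<le> (1/2)^k"
  shows "cell k p \<in> block (cell k q)"
proof -
  have "\<lfloor>2^k * fst p\<rfloor> - \<lfloor>2^k * fst q\<rfloor> \<in> {-1,0,1}" "\<lfloor>2^k * snd p\<rfloor> - \<lfloor>2^k * snd q\<rfloor> \<in> {-1,0,1}"
    using assms unfolding sup_dist_def by (simp_all only: max.bounded_iff floor_diff_le_1)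
  then show ?thesis unfolding block_def cell_def
    by (intro image_eqI[of _ _ "(\<lfloor>2^k * fst p\<rfloor> - \<lfloor>2^k * fst q\<rfloor>, \<lfloor>2^k * snd p\<rfloor> - \<lfloor>2^k * snd q\<rfloor>)"]) auto
qed

text \<open>A ball of radius \<open>(1/2)^i\<close> in the maximum metric is contained in the 3 by 3
  block of cells around its centre.\<close>

lemma sum_ball_le:
  assumes T: "finite T" and w: "\<And>x. w x \<ge> (0::real)" and b: "\<And>q. sum w {x\<in>T. cell i x = q} \<le> b"
  shows "sum w {y\<in>T. sup_dist x y \<le> (1/2)^i} \<le> 9 * b"
proof -
  have b0: "b \<ge> 0" using b[of undefined] sum_nonneg[of "{x\<in>T. cell i x = undefined}" w] w by force
  have "cell i y \<in> block (cell i x)" if "sup_dist x y \<le> (1/2)^i" for y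
    using that by (intro cell_in_block) (simp add: sup_dist_def abs_minus_commute)
  then have "{y\<in>T. sup_dist x y \<le> (1/2)^i} \<subseteq> (\<Union>q\<in>block (cell i x). {y\<in>T. cell i y = q})"
    by blast
  then have "sum w {y\<in>T. sup_dist x y \<le> (1/2)^i} \<le> sum w (\<Union>q\<in>block (cell i x). {y\<in>T. cell i y = q})"
    using T w finite_block by (intro sum_mono2) auto
  also have "\<dots> = (\<Sum>q\<in>block (cell i x). sum w {y\<in>T. cell i y = q})"
    using T finite_block by (intro sum.UNION_disjoint) auto
  also have "\<dots> \<le> (\<Sum>q\<in>block (cell i x). b)" by (intro sum_mono b)
  also have "\<dots> = real (card (block (cell i x))) * b" by simp
  also have "\<dots> \<le> 9 * b" using card_block_le[of "cell i x"] b0 by (intro mult_right_mono) auto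
  finally show ?thesis .
qed

lemma geometric_tail_le:
  assumes "0 \<le> c" "c < (1::real)"
  shows "(\<Sum>i\<in>{k..n}. c^i) \<le> c^k / (1 - c)"
proof (cases "k \<le> n")
  case True
  have "(\<Sum>i\<in>{k..n}. c^i) = (c^k - c^Suc n) / (1 - c)"
    using True assms by (simp add: sum_gp)
  also have "\<dots> \<le> c^k / (1 - c)" using assms by (intro divide_right_mono) auto
  finally show ?thesis .
qed (use assms in auto)

text \<open>Discrete form of the \<open>u\<close>-energy, with \<open>\<gamma> = 2 powr u\<close>, of the slices of \<open>w\<close> by the lines of slope
  \<open>m\<close>, thickened to width of order \<open>2^-n\<close>.\<close>
definition energy :: "nat \<Rightarrow> real \<Rightarrow> (real \<times> real \<Rightarrow> real) \<Rightarrow> (real \<times> real) set \<Rightarrow> real \<Rightarrow> real" where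
  "energy n \<gamma> w T m = (\<Sum>k\<le>n. \<gamma>^k * (\<Sum>x\<in>T. \<Sum>y\<in>{y\<in>T. cell k y = cell k x}.
      w x * w y * (2^n * indicator (close_slopes n x y) m)))"

lemma integrable_energy: "integrable lborel (energy n \<gamma> w T)"
  unfolding energy_def
  by (intro Bochner_Integration.integrable_sum integrable_mult_right integrable_real_indicator)
     (auto simp: emeasure_close_slopes_finite)

lemma energy_nonneg:
  assumes "\<And>x. w x \<ge> 0" "\<gamma> \<ge> 0"
  shows "energy n \<gamma> w T m \<ge> 0"
  unfolding energy_def using assms by (intro sum_nonneg mult_nonneg_nonneg) auto

text \<open>Averaging over slopes turns the strip indicator into a reciprocal distance, of size
  \<open>2^i\<close> on balls of mass at most \<open>9 * B^i\<close>. The sum over \<open>i\<close>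
  from \<open>k\<close> on converges because \<open>2 * B < 1\<close>, and the remaining sum over
  \<open>k\<close> because \<open>\<gamma> * (2 * B) < 1\<close>. The factor 72 is 8 from the kernel
  times 9 from the block; the bound does not depend on \<open>n\<close>.\<close>

lemma integral_energy_le:
  fixes B \<gamma> :: real
  assumes T: "finite T" and w: "\<And>x. w x \<ge> (0::real)"
    and b: "\<And>k q. k \<le> n \<Longrightarrow> sum w {x\<in>T. cell k x = q} \<le> B^k"
    and B: "0 \<le> B" "2 * B < 1" and \<gamma>: "0 \<le> \<gamma>" "\<gamma> * (2 * B) < 1"
  shows "integral\<^sup>L lborel (energy n \<gamma> w T) \<le> 72 * sum w T / ((1 - 2 * B) * (1 - \<gamma> * (2 * B)))"
proof -
  have "integral\<^sup>L lborel (energy n \<gamma> w T) = (\<Sum>k\<le>n. \<gamma>^k * (\<Sum>x\<in>T. \<Sum>y\<in>{y\<in>T. cell k y = cell k x}.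
      w x * w y * (2^n * measure lborel (close_slopes n x y))))"
  proof -
    have int: "integrable lborel (\<lambda>m. indicat_real (close_slopes n x y) m)" for x y
      by (intro integrable_real_indicator) (auto simp: emeasure_close_slopes_finite)
    show ?thesis unfolding energy_def
      by (simp add: int Bochner_Integration.integral_sum Bochner_Integration.integrable_sum)
  qed
  also have "\<dots> \<le> (\<Sum>k\<le>n. \<gamma>^k * (72 * sum w T * ((2 * B)^k / (1 - 2 * B))))"
  proof (intro sum_mono mult_left_mono)
    fix k assume "k \<in> {..n}"
    then have k: "k \<le> n" by simp
    have inner: "(\<Sum>y\<in>{y\<in>T. cell k y = cell k x}. w y * (2^n * measure lborel (close_slopes n x y)))
        \<le> 72 * ((2 * B)^k / (1 - 2 * B))" for x
    proof -
      have "(\<Sum>y\<in>{y\<in>T. cell k y = cell k x}. w y * (2^n * measure lborel (close_slopes n x y)))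
          \<le> (\<Sum>y\<in>{y\<in>T. cell k y = cell k x}. w y * (8 * (\<Sum>i\<in>{k..n}. if sup_dist x y \<le> (1/2)^i then 2^i else 0)))"
        using w k by (intro sum_mono mult_left_mono kernel_le_dyadic_sum sup_dist_le_of_cell_eq) auto
      \<comment> \<open>The restriction to one cell may be dropped: the dyadic sum starts at level
        \<open>k\<close> and so remembers that the points are close.\<close>
      also have "\<dots> \<le> (\<Sum>y\<in>T. w y * (8 * (\<Sum>i\<in>{k..n}. if sup_dist x y \<le> (1/2)^i then 2^i else 0)))"
        using T w by (intro sum_mono2) (auto intro!: mult_nonneg_nonneg sum_nonneg)
      also have "\<dots> = (\<Sum>y\<in>T. \<Sum>i\<in>{k..n}. 8 * 2^i * (if sup_dist x y \<le> (1/2)^i then w y else 0))"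
        unfolding sum_distrib_left by (intro sum.cong) auto
      also have "\<dots> = (\<Sum>i\<in>{k..n}. \<Sum>y\<in>T. 8 * 2^i * (if sup_dist x y \<le> (1/2)^i then w y else 0))"
        by (rule sum.swap)
      also have "\<dots> = (\<Sum>i\<in>{k..n}. 8 * 2^i * sum w {y\<in>T. sup_dist x y \<le> (1/2)^i})"
        using T by (intro sum.cong) (auto simp: sum_distrib_left[symmetric] sum.inter_filter)
      also have "\<dots> \<le> (\<Sum>i\<in>{k..n}. 8 * 2^i * (9 * B^i))"
        using T w b by (intro sum_mono mult_left_mono sum_ball_le) auto
      also have "\<dots> = 72 * (\<Sum>i\<in>{k..n}. (2 * B)^i)"
        unfolding sum_distrib_left by (intro sum.cong) (auto simp: power_mult_distrib)
      also have "\<dots> \<le> 72 * ((2 * B)^k / (1 - 2 * B))"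
        using B by (intro mult_left_mono geometric_tail_le) auto
      finally show ?thesis .
    qed
    have "(\<Sum>x\<in>T. \<Sum>y\<in>{y\<in>T. cell k y = cell k x}. w x * w y * (2^n * measure lborel (close_slopes n x y)))
        = (\<Sum>x\<in>T. w x * (\<Sum>y\<in>{y\<in>T. cell k y = cell k x}. w y * (2^n * measure lborel (close_slopes n x y))))"
      unfolding sum_distrib_left by (intro sum.cong) auto
    also have "\<dots> \<le> (\<Sum>x\<in>T. w x * (72 * ((2 * B)^k / (1 - 2 * B))))"
      using w inner by (intro sum_mono mult_left_mono) auto
    also have "\<dots> = 72 * sum w T * ((2 * B)^k / (1 - 2 * B))"
      unfolding sum_distrib_right[symmetric] by (simp add: mult_ac)
    finally show "(\<Sum>x\<in>T. \<Sum>y\<in>{y\<in>T. cell k y = cell k x}. w x * w y * (2^n * measure lborel (close_slopes n x y)))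
        \<le> 72 * sum w T * ((2 * B)^k / (1 - 2 * B))" .
  qed (use \<gamma> in auto)
  also have "\<dots> = 72 * sum w T / (1 - 2 * B) * (\<Sum>k\<in>{0..n}. (\<gamma> * (2 * B))^k)"
    unfolding sum_distrib_left by (intro sum.cong) (auto simp: power_mult_distrib)
  also have "\<dots> \<le> 72 * sum w T / (1 - 2 * B) * ((\<gamma> * (2 * B))^0 / (1 - \<gamma> * (2 * B)))"
    using w B \<gamma> by (intro mult_left_mono geometric_tail_le divide_nonneg_nonneg mult_nonneg_nonneg sum_nonneg) auto
  finally show ?thesis by simp
qed

section \<open>Large sections\<close>

lemma dist_le_2_sup_dist: "dist p q \<le> 2 * sup_dist p q"
proof -
  have "dist p q = sqrt ((fst p - fst q)\<^sup>2 + (snd p - snd q)\<^sup>2)"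
    by (cases p; cases q) (simp add: dist_Pair_Pair dist_real_def)
  also have "\<dots> \<le> \<bar>fst p - fst q\<bar> + \<bar>snd p - snd q\<bar>" by (rule sqrt_sum_squares_le_sum_abs)
  finally show ?thesis unfolding sup_dist_def by (smt (verit))
qed

lemma half_power_powr: "((1/2)^k) powr u = ((2::real) powr - u)^k"
proof -
  have "(1/2::real)^k = 2 powr - real k" by (simp add: powr_minus_divide powr_realpow power_one_over)
  then show ?thesis by (simp add: powr_powr powr_power mult.commute)
qed

text \<open>Passing from cells to their diameters costs the factor \<open>2 powr t\<close>, whatever
  the cover, so arbitrarily cheap cell covers would make \<open>A\<close> null. Since \<kappa> does
  not depend on the levels used, the scale can be chosen after it.\<close>

lemma dyadic_content_pos:
  assumes N: "\<not> hnull t A" and t: "t > 0"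
  obtains \<kappa> where "\<kappa> > 0" "\<And>G. finite G \<Longrightarrow> cell_cover G A \<Longrightarrow> \<kappa> \<le> (\<Sum>(k, q)\<in>G. (2 powr - t)^k)"
proof -
  have "\<exists>\<kappa>>0. \<forall>G. finite G \<and> cell_cover G A \<longrightarrow> \<kappa> \<le> (\<Sum>(k, q)\<in>G. (2 powr - t)^k)"
  proof (rule ccontr)
    assume "\<not> ?thesis"
    then have ex: "\<exists>G. finite G \<and> cell_cover G A \<and> (\<Sum>(k, q)\<in>G. (2 powr - t)^k) < \<kappa>" if "\<kappa> > 0" for \<kappa> :: real
      using that by (meson not_le)
    define C where "C = (\<lambda>(k, q). {p. cell k p = q})"
    have dC: "dist x y \<le> 2 * (1/2)^k" if "x \<in> C (k, q)" "y \<in> C (k, q)" for x y k q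
      using dist_le_2_sup_dist[of x y] sup_dist_le_of_cell_eq[of k x y] that by (simp add: C_def)
    have bC: "bounded (C (k, q))" for k q
      unfolding bounded_two_points using dC by blast
    have diamC: "diameter (C (k, q)) powr t \<le> 2 powr t * (2 powr - t)^k" for k q
    proof -
      have "diameter (C (k, q)) \<le> 2 * (1/2)^k"
        using dC by (intro diameter_le) (auto simp: dist_norm)
      then have "diameter (C (k, q)) powr t \<le> (2 * (1/2)^k) powr t"
        using t diameter_ge_0[OF bC] by (intro powr_mono2) auto
      also have "\<dots> = 2 powr t * ((1/2)^k) powr t" by (simp add: powr_mult)
      finally show ?thesis by (simp only: half_power_powr)
    qed
    have "hnull t A"
    proof (rule hnull_of_finite_covers[OF t])
      fix \<epsilon> :: real assume e: "\<epsilon> > 0"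
      then have "\<epsilon> / 2 powr t > 0" by simp
      then obtain G where G: "finite G" "cell_cover G A" "(\<Sum>(k, q)\<in>G. (2 powr - t)^k) < \<epsilon> / 2 powr t"
        using ex by blast
      have "(\<Sum>Q\<in>G. diameter (C Q) powr t) \<le> (\<Sum>(k, q)\<in>G. 2 powr t * (2 powr - t)^k)"
        using diamC by (intro sum_mono) auto
      also have "\<dots> = 2 powr t * (\<Sum>(k, q)\<in>G. (2 powr - t)^k)"
        by (simp add: sum_distrib_left case_prod_unfold)
      also have "\<dots> < \<epsilon>" using G(3) by (simp add: field_simps)
      finally have "(\<Sum>Q\<in>G. diameter (C Q) powr t) < \<epsilon>" .
      moreover have "A \<subseteq> (\<Union>Q\<in>G. C Q)" using G(2) unfolding cell_cover_def C_def by fast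
      ultimately show "\<exists>I (C :: nat \<times> int \<times> int \<Rightarrow> (real \<times> real) set). finite I \<and> A \<subseteq> (\<Union>i\<in>I. C i) \<and> (\<forall>i\<in>I. bounded (C i)) \<and> (\<Sum>i\<in>I. diameter (C i) powr t) < \<epsilon>"
        using G(1) bC by (intro exI[of _ G] exI[of _ C]) auto
    qed
    then show False using N by simp
  qed
  then show thesis using that by blast
qed

text \<open>With \<open>h = 2 powr - u\<close> this reads a dyadic level off the cost of a covering
  set, losing at most the factor \<open>1 / h\<close>.\<close>

lemma ex_geometric_scale:
  assumes h: "0 < h" "h < (1::real)" and r: "0 < r" "r < 1"
  obtains k :: nat where "r \<le> h^k" "h * h^k < r"
proof -
  define k' where "k' = (LEAST k. h^k < r)"
  have k': "h^k' < r" unfolding k'_def by (rule LeastI_ex) (rule real_arch_pow_inv[OF r(1) h(2)])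
  then have "k' \<noteq> 0" using r by (intro notI) simp
  then obtain k where k: "k' = Suc k" using not0_implies_Suc by blast
  have "\<not> h^k < r"
  proof
    assume "h^k < r"
    then have "k' \<le> k" unfolding k'_def by (rule Least_le)
    then show False using k by simp
  qed
  then show thesis using that[of k] k' k by simp
qed

lemma continuous_on_proj: "continuous_on S (proj m)"
  unfolding proj_def by (intro continuous_intros)

text \<open>After enlargement to open squares, finitely many covering sets suffice by compactness.
  What they miss of \<open>A\<close> is compact and disjoint from the line, hence its projection
  stays at a positive distance from \<open>c\<close>.\<close>

lemma finite_cell_cover_near_null_section:
  fixes A :: "(real \<times> real) set"
  assumes A: "compact A" and N: "hnull u (A \<inter> line m c)" and u: "u > 0" and e: "\<epsilon> > 0"
  obtains n G where "finite G" "\<forall>(k, q)\<in>G. k \<le> n" "(\<Sum>(k, q)\<in>G. (2 powr - u)^k) < \<epsilon>"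
    "cell_cover G {p\<in>A. \<bar>proj m p - c\<bar> < (1/2)^n}"
proof -
  define h where "h = (2::real) powr - u"
  have h: "0 < h" "h < 1" using u by (auto simp: h_def powr_minus_divide)
  \<comment> \<open>The bound 1/2 keeps every \<open>r i\<close> below 1. In the other term, 36 is 9
    for the cells of a block, 2 for the two summands of \<open>r\<close>, and 2 to spare for
    strictness; \<open>h\<close> pays for rounding to a level.\<close>
  define \<epsilon>' where "\<epsilon>' = min (1/2) (\<epsilon> * h / 36)"
  have e': "\<epsilon>' > 0" "\<epsilon>' \<le> 1/2" "\<epsilon>' \<le> \<epsilon> * h / 36" using e h unfolding \<epsilon>'_def by (auto simp: min_def)
  obtain C where C: "A \<inter> line m c \<subseteq> (\<Union>i. C i)" "\<And>i. bounded (C i)"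
      "(\<Sum>i. ennreal (diameter (C i) powr u)) < ennreal \<epsilon>'"
    using hnullE[OF N e'(1)] by metis
  \<comment> \<open>The summable positive term gives sets of diameter 0 a finite level as well, and
    makes room for an open enlargement.\<close>
  define r where "r i = diameter (C i) powr u + \<epsilon>' * (1/2)^Suc i" for i
  have r: "0 < r i" "r i < 1" for i
  proof -
    have "\<epsilon>' * (1/2)^Suc i \<le> \<epsilon>' * (1/2)" using e' power_decreasing[of 1 "Suc i" "1/2::real"] by (intro mult_left_mono) auto
    then have "\<epsilon>' * (1/2)^Suc i \<le> 1/4" using e' by linarith
    then show "r i < 1" using ennreal_term_less_of_suminf_less[OF C(3), of i] e' unfolding r_def by simp
    have "0 < \<epsilon>' * (1/2)^Suc i" using e' by (intro mult_pos_pos) auto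
    then show "0 < r i" unfolding r_def by (simp add: add_nonneg_pos)
  qed
  have "\<exists>k. r i \<le> h^k \<and> h * h^k < r i" for i using ex_geometric_scale[OF h r] by metis
  then obtain k where k: "\<And>i. r i \<le> h^k i" "\<And>i. h * h^k i < r i" by metis
  define pt where "pt i = (SOME p. p \<in> C i)" for i
  define U where "U i = {p. \<bar>fst p - fst (pt i)\<bar> < (1/2)^k i \<and> \<bar>snd p - snd (pt i)\<bar> < (1/2)^k i}" for i
  have "open (U i)" for i
    unfolding U_def by (intro open_Collect_conj open_Collect_less continuous_intros)
  have CU: "C i \<subseteq> U i" for i
  proof
    fix p assume p: "p \<in> C i"
    have "diameter (C i) powr u < r i" using e' by (simp add: r_def)
    also have "\<dots> \<le> ((1/2)^k i) powr u" using k(1)[of i] by (simp only: half_power_powr h_def)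
    finally have "diameter (C i) < (1/2)^k i"
      using powr_mono2[of u "(1/2)^k i" "diameter (C i)"] u by (meson less_imp_le not_le zero_le_power zero_le_divide_1_iff zero_le_numeral)
    moreover have "dist p (pt i) \<le> diameter (C i)"
      using p C(2) by (intro diameter_bounded_bound) (auto simp: pt_def intro: someI)
    ultimately have "dist p (pt i) < (1/2)^k i" by simp
    then show "p \<in> U i" unfolding U_def
      using dist_fst_le[of p "pt i"] dist_snd_le[of p "pt i"] by (simp add: dist_real_def)
  qed
  have "closed (line m c)"
    unfolding line_def by (intro closed_Collect_eq continuous_on_proj continuous_on_const)
  with A have "compact (A \<inter> line m c)" by (rule compact_Int_closed)
  moreover have "A \<inter> line m c \<subseteq> (\<Union>i\<in>UNIV. U i)"
    by (rule order_trans[OF C(1) UN_mono[OF subset_refl CU]])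
  ultimately obtain I where I: "finite I" "A \<inter> line m c \<subseteq> (\<Union>i\<in>I. U i)"
    using \<open>\<And>i. open (U i)\<close> by (metis compactE_image)
  define G where "G = (\<lambda>(i, q). (k i, q)) ` (SIGMA i:I. block (cell (k i) (pt i)))"
  have finG: "finite G" unfolding G_def using I(1) finite_block by blast
  have sumG: "(\<Sum>(k, q)\<in>G. h^k) < \<epsilon>"
  proof -
    have "(\<Sum>(k, q)\<in>G. h^k) \<le> (\<Sum>(i, q)\<in>(SIGMA i:I. block (cell (k i) (pt i))). h^k i)"
      unfolding G_def
      by (rule order_trans[OF sum_image_le]) (use I(1) finite_block h in \<open>auto simp: comp_def case_prod_unfold\<close>)
    also have "\<dots> = (\<Sum>i\<in>I. \<Sum>q\<in>block (cell (k i) (pt i)). h^k i)"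
      using I(1) finite_block by (intro sum.Sigma[symmetric]) auto
    also have "\<dots> \<le> (\<Sum>i\<in>I. 9 * h^k i)"
      using h card_block_le by (intro sum_mono) (simp add: mult_right_mono)
    also have "\<dots> \<le> (\<Sum>i\<in>I. 9 / h * r i)"
      using h k(2) by (intro sum_mono) (simp add: field_simps less_imp_le)
    also have "\<dots> = 9 / h * ((\<Sum>i\<in>I. diameter (C i) powr u) + \<epsilon>' * (\<Sum>i\<in>I. (1/2)^Suc i))"
      unfolding r_def sum_distrib_left sum.distrib[symmetric] by (simp add: algebra_simps)
    also have "\<dots> \<le> 9 / h * (\<epsilon>' + \<epsilon>' * 1)"
    proof (intro mult_left_mono add_mono)
      have "ennreal (\<Sum>i\<in>I. diameter (C i) powr u) = (\<Sum>i\<in>I. ennreal (diameter (C i) powr u))"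
        by simp
      also have "\<dots> \<le> (\<Sum>i. ennreal (diameter (C i) powr u))"
        using I(1) by (intro sum_le_suminf) auto
      also have "\<dots> \<le> ennreal \<epsilon>'" using C(3) by simp
      finally show "(\<Sum>i\<in>I. diameter (C i) powr u) \<le> \<epsilon>'" using e' by simp
      have "(\<Sum>i\<in>I. (1/2::real)^Suc i) \<le> (\<Sum>i. (1/2)^Suc i)"
        using I(1) power_half_series by (intro sum_le_suminf) (auto simp: sums_iff)
      then show "(\<Sum>i\<in>I. (1/2::real)^Suc i) \<le> 1" using power_half_series by (simp add: sums_iff)
    qed (use e' h in auto)
    also have "\<dots> \<le> 9 / h * (\<epsilon> * h / 36 + \<epsilon> * h / 36 * 1)"
      using e' h by (intro mult_left_mono add_mono mult_right_mono) auto
    also have "\<dots> < \<epsilon>" using h e by (simp add: field_simps)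
    finally show ?thesis .
  qed
  have covU: "\<exists>(k, q)\<in>G. cell k p = q" if "i \<in> I" "p \<in> U i" for i p
  proof -
    have "cell (k i) p \<in> block (cell (k i) (pt i))"
      using that(2) by (intro cell_in_block) (auto simp: U_def sup_dist_def)
    then have "(k i, cell (k i) p) \<in> G" using that(1) unfolding G_def by (intro image_eqI[of _ _ "(i, cell (k i) p)"]) auto
    then show ?thesis by blast
  qed
  define A' where "A' = A - (\<Union>i\<in>I. U i)"
  have "compact A'" unfolding A'_def using A \<open>\<And>i. open (U i)\<close> by (intro compact_diff) auto
  have "\<exists>\<delta>>0. \<forall>p\<in>A'. \<delta> \<le> \<bar>proj m p - c\<bar>"
  proof (cases "A' = {}")
    case False
    have "continuous_on A' (\<lambda>p. \<bar>proj m p - c\<bar>)" by (intro continuous_intros continuous_on_proj)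
    then obtain p where p: "p \<in> A'" "\<forall>y\<in>A'. \<bar>proj m p - c\<bar> \<le> \<bar>proj m y - c\<bar>"
      using continuous_attains_inf[OF \<open>compact A'\<close> False] by blast
    have "proj m p \<noteq> c" using p(1) I(2) unfolding A'_def line_def by blast
    then show ?thesis using p(2) by (intro exI[of _ "\<bar>proj m p - c\<bar>"]) auto
  qed (auto intro: exI[of _ 1])
  then obtain \<delta> where \<delta>: "\<delta> > 0" "\<And>p. p \<in> A' \<Longrightarrow> \<delta> \<le> \<bar>proj m p - c\<bar>" by blast
  obtain n0 where n0: "(1/2::real)^n0 < \<delta>" using real_arch_pow_inv[OF \<delta>(1), of "1/2"] by auto
  \<comment> \<open>The sum stands in for the maximum of \<open>n0\<close> and all levels used,
    including the case of an empty \<open>I\<close>.\<close>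
  define n where "n = n0 + sum k I"
  have "n0 \<le> n" unfolding n_def by (rule le_add1)
  then have "(1/2::real)^n \<le> (1/2)^n0" by (rule power_decreasing) simp_all
  then have n: "(1/2::real)^n < \<delta>" using n0 by (rule order_le_less_trans)
  show thesis
  proof (rule that[of G n])
    show "\<forall>(k, q)\<in>G. k \<le> n"
    proof -
      have "k i \<le> n" if "i \<in> I" for i
        using member_le_sum[of i I k] I(1) that by (simp add: n_def)
      then show ?thesis unfolding G_def by auto
    qed
    show "cell_cover G {p\<in>A. \<bar>proj m p - c\<bar> < (1/2)^n}"
      unfolding cell_cover_def
    proof
      fix p assume "p \<in> {p\<in>A. \<bar>proj m p - c\<bar> < (1/2)^n}"
      then have "p \<in> A" "p \<notin> A'" using \<delta>(2)[of p] n by auto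
      then obtain i where "i \<in> I" "p \<in> U i" unfolding A'_def by blast
      then show "\<exists>(k, q)\<in>G. cell k p = q" by (rule covU)
    qed
  qed (use finG sumG in \<open>simp_all add: h_def\<close>)
qed

section \<open>Mass and energy on strips\<close>

definition mass_energy :: "nat \<Rightarrow> real \<Rightarrow> (real \<times> real \<Rightarrow> real) \<Rightarrow> (real \<times> real) set \<Rightarrow> real" where
  "mass_energy n \<gamma> w S = (\<Sum>k\<le>n. \<gamma>^k * (\<Sum>x\<in>S. \<Sum>y\<in>{y\<in>S. cell k y = cell k x}. w x * w y))"

text \<open>\<open>mass_energy\<close> sums the squared cell masses, weighted by
  \<open>\<gamma>^k\<close>. Cauchy-Schwarz with weights \<open>h^k\<close> then bounds mass by
  cover cost times energy: a cheap cover cannot carry much mass of bounded energy.\<close>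

lemma square_mass_le:
  assumes S: "finite S" and w: "\<And>x. w x \<ge> (0::real)" and h: "h > 0"
    and G: "finite G" "\<forall>(k, q)\<in>G. k \<le> n" "cell_cover G S"
  shows "(sum w S)\<^sup>2 \<le> (\<Sum>(k, q)\<in>G. h^k) * mass_energy n (1/h) w S"
proof -
  define a where "a Q = sum w {x\<in>S. cell (fst Q) x = snd Q}" for Q
  have a0: "a Q \<ge> 0" for Q unfolding a_def using w by (simp add: sum_nonneg)
  have "sum w S \<le> (\<Sum>Q\<in>G. a Q)"
  proof -
    have "S = snd ` (SIGMA Q:G. {x\<in>S. cell (fst Q) x = snd Q})"
      using G(3) unfolding cell_cover_def by (force simp: image_iff)
    then have "sum w S = sum w (snd ` (SIGMA Q:G. {x\<in>S. cell (fst Q) x = snd Q}))" by simp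
    also have "\<dots> \<le> sum (w \<circ> snd) (SIGMA Q:G. {x\<in>S. cell (fst Q) x = snd Q})"
      using G(1) S w by (intro sum_image_le) auto
    also have "\<dots> = (\<Sum>Q\<in>G. a Q)"
      unfolding a_def using G(1) S by (subst sum.Sigma) (auto simp: case_prod_unfold)
    finally show ?thesis .
  qed
  then have "(sum w S)\<^sup>2 \<le> (\<Sum>Q\<in>G. a Q)\<^sup>2"
    using w by (intro power_mono sum_nonneg) auto
  also have "\<dots> = (\<Sum>Q\<in>G. sqrt (h^fst Q) * (a Q / sqrt (h^fst Q)))\<^sup>2"
    using h by simp
  also have "\<dots> \<le> (\<Sum>Q\<in>G. (sqrt (h^fst Q))\<^sup>2) * (\<Sum>Q\<in>G. (a Q / sqrt (h^fst Q))\<^sup>2)"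
    by (rule Cauchy_Schwarz_ineq_sum)
  also have "\<dots> = (\<Sum>(k, q)\<in>G. h^k) * (\<Sum>Q\<in>G. (1/h)^fst Q * (a Q)\<^sup>2)"
    using h by (simp add: power_divide case_prod_unfold)
  also have "\<dots> \<le> (\<Sum>(k, q)\<in>G. h^k) * mass_energy n (1/h) w S"
  proof (rule mult_left_mono)
    let ?P = "SIGMA k:{..n}. cell k ` S"
    have finP: "finite ?P" using S by auto
    \<comment> \<open>Cells of \<open>G\<close> that miss \<open>S\<close> carry no mass; all others
      occur in the energy because their level is at most \<open>n\<close>.\<close>
    have "(\<Sum>Q\<in>G. (1/h)^fst Q * (a Q)\<^sup>2) = (\<Sum>Q\<in>G \<inter> ?P. (1/h)^fst Q * (a Q)\<^sup>2)"
    proof (rule sum.mono_neutral_right)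
      show "\<forall>Q\<in>G - G \<inter> ?P. (1/h)^fst Q * (a Q)\<^sup>2 = 0"
      proof
        fix Q assume Q: "Q \<in> G - G \<inter> ?P"
        then have no: "{x\<in>S. cell (fst Q) x = snd Q} = {}" using G(2) by (cases Q) force
        show "(1/h)^fst Q * (a Q)\<^sup>2 = 0" unfolding a_def no by simp
      qed
    qed (use G in auto)
    also have "\<dots> \<le> (\<Sum>Q\<in>?P. (1/h)^fst Q * (a Q)\<^sup>2)"
      using finP h by (intro sum_mono2) auto
    also have "\<dots> = (\<Sum>k\<le>n. \<Sum>q\<in>cell k ` S. (1/h)^k * (a (k, q))\<^sup>2)"
      using S by (subst sum.Sigma) (auto simp: case_prod_unfold)
    also have "\<dots> = mass_energy n (1/h) w S"
      unfolding mass_energy_def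
    proof (rule sum.cong[OF refl])
      fix k
      have "(\<Sum>x\<in>S. \<Sum>y\<in>{y\<in>S. cell k y = cell k x}. w x * w y) = (\<Sum>x\<in>S. w x * a (k, cell k x))"
        by (simp add: a_def sum_distrib_left)
      also have "\<dots> = (\<Sum>q\<in>cell k ` S. \<Sum>x\<in>{x\<in>S. cell k x = q}. w x * a (k, cell k x))"
        by (rule sum.image_gen[OF S])
      also have "\<dots> = (\<Sum>q\<in>cell k ` S. (a (k, q))\<^sup>2)"
      proof (rule sum.cong[OF refl])
        fix q
        have "(\<Sum>x\<in>{x\<in>S. cell k x = q}. w x * a (k, cell k x)) = (\<Sum>x\<in>{x\<in>S. cell k x = q}. w x * a (k, q))"
          by (rule sum.cong) auto
        then show "(\<Sum>x\<in>{x\<in>S. cell k x = q}. w x * a (k, cell k x)) = (a (k, q))\<^sup>2"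
          by (simp add: a_def sum_distrib_right[symmetric] power2_eq_square)
      qed
      finally show "(\<Sum>q\<in>cell k ` S. (1/h)^k * (a (k, q))\<^sup>2) =
          (1/h)^k * (\<Sum>x\<in>S. \<Sum>y\<in>{y\<in>S. cell k y = cell k x}. w x * w y)"
        by (simp add: sum_distrib_left)
    qed
    finally show "(\<Sum>Q\<in>G. (1/h)^fst Q * (a Q)\<^sup>2) \<le> mass_energy n (1/h) w S" .
  qed (use h in \<open>auto intro!: sum_nonneg\<close>)
  finally show ?thesis .
qed

definition strip :: "nat \<Rightarrow> real \<Rightarrow> (real \<times> real) set \<Rightarrow> int \<Rightarrow> (real \<times> real) set" where
  "strip n m T j = {x\<in>T. \<lfloor>2^n * proj m x\<rfloor> = j}"

text \<open>Two points in one strip have projections within \<open>(1/2)^n\<close>, so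
  \<open>m\<close> is one of their close slopes and each pair counted on the left is also counted in
  \<open>energy\<close>.\<close>

lemma sum_mass_energy_strips_le:
  assumes T: "finite T" and w: "\<And>x. w x \<ge> (0::real)" and \<gamma>: "\<gamma> \<ge> 0" and m: "m \<in> {0..1}"
  shows "2^n * (\<Sum>j\<in>(\<lambda>x. \<lfloor>2^n * proj m x\<rfloor>) ` T. mass_energy n \<gamma> w (strip n m T j)) \<le> energy n \<gamma> w T m"
proof -
  let ?f = "\<lambda>x. \<lfloor>2^n * proj m x\<rfloor>"
  define g where "g k x = (\<Sum>y\<in>{y\<in>T. cell k y = cell k x \<and> ?f y = ?f x}. w x * w y)" for k x
  have "(\<Sum>j\<in>?f ` T. mass_energy n \<gamma> w (strip n m T j)) =
      (\<Sum>j\<in>?f ` T. \<Sum>k\<le>n. \<gamma>^k * (\<Sum>x\<in>{x\<in>T. ?f x = j}. g k x))"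
    unfolding mass_energy_def strip_def g_def
    by (intro sum.cong refl arg_cong2[where f = "(*)"]) auto
  also have "\<dots> = (\<Sum>k\<le>n. \<gamma>^k * (\<Sum>j\<in>?f ` T. \<Sum>x\<in>{x\<in>T. ?f x = j}. g k x))"
    by (subst sum.swap) (simp add: sum_distrib_left)
  also have "\<dots> = (\<Sum>k\<le>n. \<gamma>^k * (\<Sum>x\<in>T. g k x))"
    by (simp add: sum.image_gen[OF T, of "g _" ?f])
  finally have "2^n * (\<Sum>j\<in>?f ` T. mass_energy n \<gamma> w (strip n m T j)) = (\<Sum>k\<le>n. \<gamma>^k * (\<Sum>x\<in>T. 2^n * g k x))"
    by (simp add: sum_distrib_left mult_ac)
  also have "\<dots> \<le> energy n \<gamma> w T m"
    unfolding energy_def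
  proof (intro sum_mono mult_left_mono)
    fix k x assume "x \<in> T"
    have "2^n * g k x = (\<Sum>y\<in>{y\<in>T. cell k y = cell k x \<and> ?f y = ?f x}. w x * w y * (2^n * indicator (close_slopes n x y) m))"
      unfolding g_def sum_distrib_left
    proof (rule sum.cong[OF refl])
      fix y assume "y \<in> {y\<in>T. cell k y = cell k x \<and> ?f y = ?f x}"
      then have "m \<in> close_slopes n x y"
        using m abs_less_of_floor_eq[of n "proj m x" "proj m y"] by (auto simp: close_slopes_def)
      then show "2^n * (w x * w y) = w x * w y * (2^n * indicator (close_slopes n x y) m)" by simp
    qed
    also have "\<dots> \<le> (\<Sum>y\<in>{y\<in>T. cell k y = cell k x}. w x * w y * (2^n * indicator (close_slopes n x y) m))"
      using T w by (intro sum_mono2) auto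
    finally show "2^n * g k x \<le> (\<Sum>y\<in>{y\<in>T. cell k y = cell k x}. w x * w y * (2^n * indicator (close_slopes n x y) m))" .
  qed (use \<gamma> in auto)
  finally show ?thesis .
qed

lemma sum_le_sqrt_of_squares:
  fixes a e :: "'i \<Rightarrow> real"
  assumes "finite I" "\<And>i. i \<in> I \<Longrightarrow> (a i)\<^sup>2 \<le> c * e i" "real (card I) \<le> M" "c \<ge> 0" "sum e I \<le> E" "\<And>i. i \<in> I \<Longrightarrow> e i \<ge> 0"
  shows "sum a I \<le> sqrt (M * (c * E))"
proof (rule real_le_rsqrt)
  have "(sum a I)\<^sup>2 = (\<Sum>i\<in>I. 1 * a i)\<^sup>2" by simp
  also have "\<dots> \<le> (\<Sum>i\<in>I. 1\<^sup>2) * (\<Sum>i\<in>I. (a i)\<^sup>2)" by (rule Cauchy_Schwarz_ineq_sum)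
  also have "\<dots> = real (card I) * (\<Sum>i\<in>I. (a i)\<^sup>2)" by simp
  also have "\<dots> \<le> real (card I) * (\<Sum>i\<in>I. c * e i)"
    using assms(2) by (intro mult_left_mono sum_mono) auto
  also have "\<dots> = real (card I) * (c * sum e I)" by (simp add: sum_distrib_left)
  also have "\<dots> \<le> M * (c * E)"
    using assms by (intro mult_mono mult_left_mono mult_nonneg_nonneg sum_nonneg) auto
  finally show "(sum a I)\<^sup>2 \<le> M * (c * E)" .
qed

lemma mass_energy_nonneg:
  assumes "\<And>x. w x \<ge> (0::real)" "\<gamma> \<ge> 0"
  shows "mass_energy n \<gamma> w S \<ge> 0"
  unfolding mass_energy_def using assms by (intro sum_nonneg mult_nonneg_nonneg) auto

text \<open>The strip energies add up to at most \<open>\<Phi> / 2^n\<close>, while the strips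
  number at most \<open>2 * real R * 2^n\<close>, of which at most \<open>\<zeta> * 2^n\<close> are
  bad. In Cauchy-Schwarz over the strips the powers of 2 cancel, leaving a bound free of
  \<open>n\<close>.\<close>

lemma mass_le_good_bad_strips:
  fixes R :: nat and w :: "real \<times> real \<Rightarrow> real"
  assumes T: "finite T" and w: "\<And>x. w x \<ge> 0" and h: "h > 0" and m: "m \<in> {0..1}"
    and R: "\<And>x. x \<in> T \<Longrightarrow> \<bar>proj m x\<bar> < R"
    and cov: "\<And>c. c \<in> {-real R..real R} - Z \<Longrightarrow> \<exists>G. finite G \<and> (\<forall>(k, q)\<in>G. k \<le> n) \<and>
      (\<Sum>(k, q)\<in>G. h^k) \<le> \<epsilon> \<and> cell_cover G {x\<in>T. \<bar>proj m x - c\<bar> < (1/2)^n}"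
    and Z: "Z \<in> sets borel" "emeasure lborel Z \<le> ennreal \<zeta>" "\<zeta> \<ge> 0"
    and \<Phi>: "energy n (1/h) w T m \<le> \<Phi>"
    and N0: "real (card (cell 0 ` T)) \<le> N0" and e: "\<epsilon> \<ge> 0"
  shows "sum w T \<le> sqrt (2 * real R * (\<epsilon> * \<Phi>)) + sqrt (\<zeta> * (N0 * \<Phi>))"
proof -
  define f where "f x = \<lfloor>2^n * proj m x\<rfloor>" for x
  define J where "J = f ` T"
  define S where "S j = strip n m T j" for j
  have S: "S j = {x\<in>T. f x = j}" for j by (simp add: S_def strip_def f_def)
  define en where "en j = mass_energy n (1/h) w (S j)" for j
  have en0: "en j \<ge> 0" for j unfolding en_def using w h by (intro mass_energy_nonneg) auto
  have finJ: "finite J" unfolding J_def using T by simp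
  have enJ: "2^n * sum en J \<le> \<Phi>"
    using sum_mass_energy_strips_le[OF T w _ m, of "1/h" n] h \<Phi>
    unfolding J_def f_def en_def S_def by (meson order_trans divide_nonneg_pos zero_le_one)
  have sub_en: "sum en I \<le> \<Phi> / 2^n" if "I \<subseteq> J" for I
  proof -
    have "sum en I \<le> sum en J" using that finJ en0 by (intro sum_mono2) auto
    then have "2^n * sum en I \<le> 2^n * sum en J" by (rule mult_left_mono) simp
    then have "2^n * sum en I \<le> \<Phi>" using enJ by (rule order_trans)
    then show ?thesis by (simp add: pos_le_divide_eq mult.commute)
  qed
  define Iv where "Iv j = {real_of_int j / 2^n ..< (real_of_int j + 1) / 2^n}" for j
  have Iv_iff: "c \<in> Iv j \<longleftrightarrow> \<lfloor>2^n * c\<rfloor> = j" for c j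
    by (simp add: Iv_def floor_eq_iff pos_divide_le_eq pos_less_divide_eq mult.commute)
  \<comment> \<open>One intercept outside \<open>Z\<close> suffices: every point of the strip
    projects within \<open>(1/2)^n\<close> of it, so its cover serves the whole strip.\<close>
  define good where "good = {j\<in>J. \<exists>c\<in>{-real R..real R} - Z. c \<in> Iv j}"
  define bad where "bad = J - good"
  have rangeJ: "- (int R * 2^n) \<le> j \<and> j < int R * 2^n" if j: "j \<in> J" for j
  proof -
    obtain x where x: "x \<in> T" "j = f x" using j unfolding J_def by blast
    have "2^n * \<bar>proj m x\<bar> < 2^n * real R" using R[OF x(1)] by simp
    then have "\<bar>2^n * proj m x\<bar> < real_of_int (int R * 2^n)" by (simp add: abs_mult mult.commute)
    then show ?thesis unfolding x(2) f_def by linarith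
  qed
  have cardJ: "real (card J) \<le> 2 * real R * 2^n"
  proof -
    have "card J \<le> card {- (int R * 2^n) ..< int R * 2^n}"
      using rangeJ by (intro card_mono) auto
    also have "\<dots> = nat (2 * (int R * 2^n))" by simp
    finally have "card J \<le> nat (2 * (int R * 2^n))" .
    then have "int (card J) \<le> 2 * (int R * 2^n)" by (subst (asm) le_nat_iff) simp_all
    then have "real_of_int (int (card J)) \<le> real_of_int (2 * (int R * 2^n))" by (rule of_int_le_iff[THEN iffD2])
    then show ?thesis by simp
  qed
  have "(sum w (S j))\<^sup>2 \<le> \<epsilon> * en j" if j: "j \<in> good" for j
  proof -
    obtain c where c: "c \<in> {-real R..real R} - Z" "\<lfloor>2^n * c\<rfloor> = j" using j unfolding good_def Iv_iff by blast
    obtain G where G: "finite G" "\<forall>(k, q)\<in>G. k \<le> n" "(\<Sum>(k, q)\<in>G. h^k) \<le> \<epsilon>"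
      "cell_cover G {x\<in>T. \<bar>proj m x - c\<bar> < (1/2)^n}" using cov[OF c(1)] by blast
    have "S j \<subseteq> {x\<in>T. \<bar>proj m x - c\<bar> < (1/2)^n}"
    proof
      fix x assume "x \<in> S j"
      then have "x \<in> T" "\<lfloor>2^n * proj m x\<rfloor> = \<lfloor>2^n * c\<rfloor>" using c(2) by (simp_all add: S f_def)
      then show "x \<in> {x\<in>T. \<bar>proj m x - c\<bar> < (1/2)^n}" using abs_less_of_floor_eq by blast
    qed
    then have "cell_cover G (S j)"
      using G(4) unfolding cell_cover_def by blast
    then have "(sum w (S j))\<^sup>2 \<le> (\<Sum>(k, q)\<in>G. h^k) * en j"
      unfolding en_def using T w h G by (intro square_mass_le) (auto simp: S)
    also have "\<dots> \<le> \<epsilon> * en j" using G(3) en0 by (rule mult_right_mono)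
    finally show ?thesis .
  qed
  moreover have "finite good" "real (card good) \<le> 2 * real R * 2^n"
    using finJ cardJ card_mono[OF finJ, of good] by (auto simp: good_def)
  ultimately have goodle: "(\<Sum>j\<in>good. sum w (S j)) \<le> sqrt (2 * real R * 2^n * (\<epsilon> * (\<Phi> / 2^n)))"
    using e sub_en[of good] en0 by (intro sum_le_sqrt_of_squares[where e = en]) (auto simp: good_def)
  have "(sum w (S j))\<^sup>2 \<le> N0 * en j" for j
  proof -
    \<comment> \<open>On bad strips only the trivial cover by unit cells is available, at cost
      \<open>h^0 = 1\<close> per cell. Their small number has to compensate.\<close>
    let ?G = "Pair 0 ` (cell 0 ` T)"
    have "cell_cover ?G (S j)" unfolding cell_cover_def S by auto
    then have "(sum w (S j))\<^sup>2 \<le> (\<Sum>(k, q)\<in>?G. h^k) * en j"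
      unfolding en_def using T w h by (intro square_mass_le) (auto simp: S)
    also have "(\<Sum>(k, q)\<in>?G. h^k) = real (card (cell 0 ` T))"
      by (subst sum.reindex) (auto simp: inj_on_def)
    also have "\<dots> * en j \<le> N0 * en j" using N0 en0 by (rule mult_right_mono)
    finally show ?thesis .
  qed
  moreover have "finite bad" unfolding bad_def using finJ by simp
  moreover have "real (card bad) \<le> \<zeta> * 2^n"
  proof -
    have "Iv j \<subseteq> Z" if "j \<in> bad" for j
    proof
      fix c assume c: "c \<in> Iv j"
      have j: "j \<in> J" "j \<notin> good" using that by (auto simp: bad_def)
      \<comment> \<open>As \<open>R\<close> is an integer, the ends of
        \<open>{-real R..real R}\<close> are endpoints of dyadic intervals, so the interval of a
        strip meeting \<open>T\<close> lies wholly inside.\<close>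
      have "- (int R * 2^n) \<le> j" "j + 1 \<le> int R * 2^n" using rangeJ[OF j(1)] by auto
      then have "real_of_int (- (int R * 2^n)) \<le> real_of_int j" "real_of_int (j + 1) \<le> real_of_int (int R * 2^n)"
        by (simp_all only: of_int_le_iff)
      then have "(- real R) * 2^n \<le> real_of_int j" "real_of_int j + 1 \<le> real R * 2^n" by simp_all
      moreover have "real_of_int j \<le> c * 2^n" "c * 2^n < real_of_int j + 1"
        using c by (simp_all add: Iv_def pos_divide_le_eq pos_less_divide_eq)
      ultimately have le: "(- real R) * 2^n \<le> c * 2^n" "c * 2^n \<le> real R * 2^n" by linarith+
      have "- real R \<le> c" using le(1) by (rule mult_right_le_imp_le) simp
      moreover have "c \<le> real R" using le(2) by (rule mult_right_le_imp_le) simp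
      ultimately show "c \<in> Z" using j c unfolding good_def by auto
    qed
    then have "emeasure lborel (\<Union>j\<in>bad. Iv j) \<le> emeasure lborel Z"
      using Z(1) by (intro emeasure_mono) auto
    also have "emeasure lborel (\<Union>j\<in>bad. Iv j) = (\<Sum>j\<in>bad. emeasure lborel (Iv j))"
    proof (rule sum_emeasure[symmetric])
      show "disjoint_family_on Iv bad" unfolding disjoint_family_on_def by (auto simp: Iv_iff)
    qed (use \<open>finite bad\<close> in \<open>auto simp: Iv_def\<close>)
    also have "\<dots> = (\<Sum>j\<in>bad. ennreal (1/2^n))"
      by (intro sum.cong refl) (simp add: Iv_def diff_divide_distrib[symmetric] divide_right_mono)
    also have "\<dots> = ennreal (real (card bad) * (1/2^n))"
      by (subst sum_ennreal) auto
    finally have "ennreal (real (card bad) * (1/2^n)) \<le> ennreal \<zeta>" using Z(2) by (rule order_trans)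
    then have "real (card bad) * (1/2^n) \<le> \<zeta>" using Z(3) by simp
    then show ?thesis by (simp add: field_simps)
  qed
  ultimately have badle: "(\<Sum>j\<in>bad. sum w (S j)) \<le> sqrt (\<zeta> * 2^n * (N0 * (\<Phi> / 2^n)))"
    using N0 sub_en[of bad] en0 by (intro sum_le_sqrt_of_squares[where e = en]) (auto simp: bad_def)
  have "sum w T = (\<Sum>j\<in>J. sum w (S j))" unfolding S J_def by (rule sum.image_gen[OF T])
  also have "\<dots> = (\<Sum>j\<in>good. sum w (S j)) + (\<Sum>j\<in>bad. sum w (S j))"
    unfolding bad_def using finJ sum.subset_diff[of good J] by (auto simp: good_def add.commute)
  finally show ?thesis using goodle badle by (simp add: field_simps)
qed

text \<open>\<open>Bad n\<close> collects the lines near which \<open>A\<close> has no cheap cover by cells of level at most \<open>n\<close>. If almost all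
  sections were null, its measure would tend to 0, and at scale \<open>n\<close> a discrete Frostman measure would
  put mass less than \<open>\<kappa> / 2\<close> on the good strips (cheap cover against bounded energy) and on the bad ones
  (few strips against bounded energy).\<close>
lemma line_section_not_null:
  fixes A :: "(real \<times> real) set"
  assumes A: "compact A" and N: "\<not> hnull t A" and t: "t > 1" and u: "0 < u" "u < t - 1"
  shows "\<exists>m\<in>{0..1}. \<not> (AE c in lborel. hnull u (A \<inter> line m c))"
proof (rule ccontr)
  assume "\<not> ?thesis"
  then have null: "AE c in lborel. hnull u (A \<inter> line m c)" if "m \<in> {0..1}" for m using that by blast
  obtain \<kappa> where \<kappa>: "\<kappa> > 0" "\<And>G. finite G \<Longrightarrow> cell_cover G A \<Longrightarrow> \<kappa> \<le> (\<Sum>(k, q)\<in>G. (2 powr - t)^k)"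
    using dyadic_content_pos[OF N] t by auto
  \<comment> \<open>\<open>B^k\<close> is the mass budget at exponent \<open>t\<close>, matching the
    cell cost in the content bound; \<open>h^k\<close> is the cell cost at exponent
    \<open>u\<close>, and \<open>1 / h = 2 powr u\<close> is the energy ratio.\<close>
  define B where "B = (2::real) powr - t"
  define h where "h = (2::real) powr - u"
  have h: "h > 0" by (simp add: h_def)
  have B2: "2 * B = 2 powr (1 - t)" by (simp add: B_def powr_diff powr_minus_divide)
  have h_inverse: "1/h = 2 powr u" by (simp add: h_def powr_minus_divide)
  have hB2: "1/h * (2 * B) = 2 powr (u + (1 - t))" unfolding B2 h_inverse by (rule powr_add[symmetric])
  have "2 powr (1 - t) < (2::real) powr 0" "2 powr (u + (1 - t)) < (2::real) powr 0"
    using t u by (intro powr_less_mono; simp)+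
  then have "2 * B < 1" "1/h * (2 * B) < 1" by (simp_all only: hB2) (simp_all add: B2)
  then have B: "0 \<le> B" "2 * B < 1" "1/h * (2 * B) < 1" by (simp_all add: B_def)
  obtain b where b: "\<And>p. p \<in> A \<Longrightarrow> norm p \<le> b" using compact_imp_bounded[OF A] bounded_iff by blast
  define R where "R = nat \<lceil>2 * b\<rceil> + 1"
  have R: "\<bar>proj m p\<bar> < real R" if "p \<in> A" "m \<in> {0..1}" for m p
  proof -
    have "\<bar>proj m p\<bar> \<le> 2 * norm p"
      using abs_proj_diff_le[OF that(2), of p 0] by (simp add: proj_def)
    also have "\<dots> \<le> 2 * b" using b[OF that(1)] by simp
    also have "\<dots> < real R" unfolding R_def by linarith
    finally show ?thesis .
  qed
  have R1: "real R \<ge> 1" by (simp add: R_def)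
  define N0 where "N0 = real (card (cell 0 ` A)) + 1"
  have N0: "N0 > 0" by (simp add: N0_def)
  \<comment> \<open>Bounds the average energy at every scale. The total mass is at most
    \<open>N0\<close>, since a cell of level 0 may carry mass at most
    \<open>B^0 = 1\<close>.\<close>
  define C where "C = 72 * N0 / ((1 - 2 * B) * (1 - 1/h * (2 * B)))"
  have C: "C > 0" unfolding C_def using N0 B by (intro divide_pos_pos mult_pos_pos) auto
  \<comment> \<open>\<epsilon> and \<eta> are chosen so that, with energy below \<open>3 * C\<close>
    and bad intercepts of measure below \<open>3 * \<eta>\<close>, both square roots in the final
    estimate equal \<open>sqrt (\<kappa>\<^sup>2 / 8)\<close>, less than half of \<kappa>.\<close>
  define \<epsilon> where "\<epsilon> = \<kappa>\<^sup>2 / (48 * real R * C)"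
  have \<epsilon>: "\<epsilon> > 0" unfolding \<epsilon>_def using \<kappa> R1 C by (intro divide_pos_pos mult_pos_pos) auto
  define \<eta> where "\<eta> = \<kappa>\<^sup>2 / (72 * N0 * C)"
  have \<eta>: "\<eta> > 0" unfolding \<eta>_def using \<kappa> N0 C by (intro divide_pos_pos mult_pos_pos) auto

  \<comment> \<open>Finite families of integer-indexed cells are countable in number; together with
    the openness of \<open>unc n G\<close> this makes \<open>Bad n\<close> Borel, so its measure can
    be computed by slices.\<close>
  define fam where "fam n = {G :: (nat \<times> int \<times> int) set. finite G \<and> (\<forall>(k, q)\<in>G. k \<le> n) \<and> (\<Sum>(k, q)\<in>G. h^k) < \<epsilon>}" for n
  define unc where "unc n G = {(m, c). \<exists>p\<in>A. \<not> cell_cover G {p} \<and> \<bar>proj m p - c\<bar> < (1/2)^n}" for n G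
  define Bad where "Bad n = ({0..1} \<times> {-real R..real R}) \<inter> (\<Inter>G\<in>fam n. unc n G)" for n
  have unc_open: "open (unc n G)" for n G
  proof -
    have "unc n G = (\<Union>p\<in>{p\<in>A. \<not> cell_cover G {p}}. {x. \<bar>proj (fst x) p - snd x\<bar> < (1/2)^n})"
      unfolding unc_def by auto
    also have "open \<dots>"
      unfolding proj_def by (intro open_UN ballI open_Collect_less continuous_intros)
    finally show ?thesis .
  qed
  have countable_fam: "countable (fam n)" for n
    by (rule countable_subset[of _ "Collect finite"]) (auto simp: fam_def countable_Collect_finite)
  have Bad_sets: "Bad n \<in> sets borel" for n
    unfolding Bad_def
    by (intro sets.Int sets.countable_INT'' countable_fam borel_open unc_open borel_closed closed_Times) auto
  then have Bad_sets': "Bad n \<in> sets (lborel \<Otimes>\<^sub>M lborel)" for n by (simp only: lborel_prod sets_lborel)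
  \<comment> \<open>A larger \<open>n\<close> admits more families and asks them to cover a thinner
    tube.\<close>
  have "Bad (Suc n) \<subseteq> Bad n" for n
  proof -
    have "fam n \<subseteq> fam (Suc n)" unfolding fam_def by fastforce
    moreover have "unc (Suc n) G \<subseteq> unc n G" for G
    proof -
      have "x < (1/2)^n" if "x < (1/2)^Suc n" for x :: real
        by (rule less_le_trans[OF that]) simp
      then show ?thesis unfolding unc_def by blast
    qed
    ultimately show ?thesis unfolding Bad_def by blast
  qed
  then have dec: "decseq Bad" by (rule decseq_SucI)
  have fin: "emeasure (lborel \<Otimes>\<^sub>M lborel) (Bad n) \<noteq> \<infinity>" for n
  proof -
    have "emeasure (lborel \<Otimes>\<^sub>M lborel) (Bad n) \<le> emeasure (lborel \<Otimes>\<^sub>M lborel) ({0..1::real} \<times> {-real R..real R})"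
      by (rule emeasure_mono) (auto simp: Bad_def)
    also have "\<dots> < \<infinity>" by (subst lborel.emeasure_pair_measure_Times) (auto simp: ennreal_mult_less_top)
    finally show ?thesis by simp
  qed
  have "emeasure (lborel \<Otimes>\<^sub>M lborel) (\<Inter>n. Bad n) = 0"
  proof -
    have Int_sets: "(\<Inter>n. Bad n) \<in> sets (lborel \<Otimes>\<^sub>M lborel)" using Bad_sets' by (intro sets.countable_INT) auto
    have "emeasure lborel (Pair m -` (\<Inter>n. Bad n)) = 0" for m
    proof (cases "m \<in> {0..1}")
      case True
      have "AE c in lborel. \<not> (m, c) \<in> (\<Inter>n. Bad n)"
        using null[OF True]
      proof (rule AE_mp, intro AE_I2 impI)
        fix c assume "hnull u (A \<inter> line m c)"
        from finite_cell_cover_near_null_section[OF A this u(1) \<epsilon>]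
        obtain n G where G: "finite G" "\<forall>(k, q)\<in>G. k \<le> n" "(\<Sum>(k, q)\<in>G. (2 powr - u)^k) < \<epsilon>"
            "cell_cover G {p\<in>A. \<bar>proj m p - c\<bar> < (1/2)^n}" .
        have "G \<in> fam n" unfolding fam_def h_def using G(1,2,3) by simp
        moreover have "(m, c) \<notin> unc n G" unfolding unc_def using G(4) unfolding cell_cover_def by blast
        ultimately have "(m, c) \<notin> Bad n" unfolding Bad_def by blast
        then show "(m, c) \<notin> (\<Inter>n. Bad n)" by blast
      qed
      then have "emeasure lborel {c \<in> space lborel. (m, c) \<in> (\<Inter>n. Bad n)} = 0" by (rule emeasure_eq_0_AE)
      then show ?thesis by (simp add: vimage_def)
    next
      case False
      then have "Pair m -` (\<Inter>n. Bad n) = {}" unfolding Bad_def by auto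
      then show ?thesis by simp
    qed
    then show ?thesis by (simp add: lborel.emeasure_pair_measure_alt[OF Int_sets])
  qed
  then have "(\<lambda>n. emeasure (lborel \<Otimes>\<^sub>M lborel) (Bad n)) \<longlonglongrightarrow> 0"
    using Lim_emeasure_decseq[OF _ dec fin] Bad_sets' by (metis image_subsetI)
  then have "eventually (\<lambda>n. emeasure (lborel \<Otimes>\<^sub>M lborel) (Bad n) < ennreal \<eta>) sequentially"
    using \<eta> by (intro order_tendstoD) auto
  then obtain n where n: "emeasure (lborel \<Otimes>\<^sub>M lborel) (Bad n) < ennreal \<eta>"
    by (meson eventually_sequentially order_refl)

  obtain T w where T: "finite T" "T \<subseteq> A" and w: "\<And>x. w x \<ge> (0::real)"
    and wB: "\<And>k q. k \<le> n \<Longrightarrow> sum w {x\<in>T. cell k x = q} \<le> B^k" and mass: "\<kappa> \<le> sum w T"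
    using discrete_frostman[OF compact_imp_bounded[OF A], of "\<lambda>k. B^k" n \<kappa>] \<kappa>(2) B(1) unfolding B_def
    by (smt (verit) zero_le_power)
  have finA: "finite (cell 0 ` A)" by (rule finite_cell_image[OF compact_imp_bounded[OF A]])
  have cardT: "real (card (cell 0 ` T)) \<le> N0"
    using card_mono[OF finA image_mono[OF T(2), of "cell 0"]] unfolding N0_def by linarith
  have "sum w T = (\<Sum>q\<in>cell 0 ` T. sum w {x\<in>T. cell 0 x = q})" by (rule sum.image_gen[OF T(1)])
  also have "\<dots> \<le> (\<Sum>q\<in>cell 0 ` T. 1)" using wB[of 0] by (intro sum_mono) auto
  also have "\<dots> \<le> N0" using cardT by simp
  finally have massle: "sum w T \<le> N0" .
  define en where "en = energy n (1/h) w T"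
  have "integral\<^sup>L lborel en \<le> 72 * sum w T / ((1 - 2 * B) * (1 - 1/h * (2 * B)))"
    unfolding en_def using T(1) w wB B h by (intro integral_energy_le) auto
  also have "\<dots> \<le> C"
    unfolding C_def using massle B by (intro divide_right_mono mult_left_mono mult_nonneg_nonneg) auto
  finally have int_en: "integral\<^sup>L lborel en \<le> C" .
  have en0: "en m \<ge> 0" for m unfolding en_def using w h by (intro energy_nonneg) auto
  have en_int: "integrable lborel en" unfolding en_def by (rule integrable_energy)
  \<comment> \<open>Chebyshev with factor 3: large energy and a large bad slice each exclude slopes
    of measure at most 1/3, which cannot exhaust \<open>{0..1}\<close>.\<close>
  have "\<exists>m\<in>{0..1}. en m < 3 * C \<and> emeasure lborel (Pair m -` Bad n) < ennreal (3 * \<eta>)"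
  proof (rule ccontr)
    assume not_ex: "\<not> ?thesis"
    have ind: "indicator {0..1} m \<le> ennreal (1/(3*C)) * ennreal (en m) + ennreal (1/(3*\<eta>)) * emeasure lborel (Pair m -` Bad n)" for m
    proof (cases "m \<in> {0..1}")
      case True
      then consider "en m \<ge> 3 * C" | "emeasure lborel (Pair m -` Bad n) \<ge> ennreal (3 * \<eta>)"
        using not_ex by (meson not_le)
      then show ?thesis
      proof cases
        case 1
        then have "1 \<le> 1/(3*C) * en m" using C by (simp add: field_simps)
        then have "1 \<le> ennreal (1/(3*C)) * ennreal (en m)"
          using C en0 by (simp add: ennreal_mult[symmetric] del: ennreal_1 flip: ennreal_1)
        then show ?thesis using True by (simp add: add_increasing2)
      next
        case 2
        have "1 = ennreal (1/(3*\<eta>)) * ennreal (3*\<eta>)" using \<eta> by (simp add: ennreal_mult[symmetric])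
        also have "\<dots> \<le> ennreal (1/(3*\<eta>)) * emeasure lborel (Pair m -` Bad n)" using 2 by (rule mult_left_mono) simp
        finally show ?thesis using True by (simp add: add_increasing)
      qed
    qed simp
    have meas: "(\<lambda>m. emeasure lborel (Pair m -` Bad n)) \<in> borel_measurable lborel"
      using lborel.measurable_emeasure_Pair[OF Bad_sets'] by simp
    have "1 = (\<integral>\<^sup>+m. indicator {0..1::real} m \<partial>lborel)" by simp
    also have "\<dots> \<le> (\<integral>\<^sup>+m. ennreal (1/(3*C)) * ennreal (en m) + ennreal (1/(3*\<eta>)) * emeasure lborel (Pair m -` Bad n) \<partial>lborel)"
      by (intro nn_integral_mono ind)
    also have "\<dots> = ennreal (1/(3*C)) * (\<integral>\<^sup>+m. ennreal (en m) \<partial>lborel) + ennreal (1/(3*\<eta>)) * (\<integral>\<^sup>+m. emeasure lborel (Pair m -` Bad n) \<partial>lborel)"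
      using en_int meas by (subst nn_integral_add) (auto simp: nn_integral_cmult)
    also have "(\<integral>\<^sup>+m. ennreal (en m) \<partial>lborel) = ennreal (integral\<^sup>L lborel en)"
      using en_int en0 by (intro nn_integral_eq_integral) auto
    also have "(\<integral>\<^sup>+m. emeasure lborel (Pair m -` Bad n) \<partial>lborel) = emeasure (lborel \<Otimes>\<^sub>M lborel) (Bad n)"
      by (rule lborel.emeasure_pair_measure_alt[OF Bad_sets', symmetric])
    also have "ennreal (1/(3*C)) * ennreal (integral\<^sup>L lborel en) + ennreal (1/(3*\<eta>)) * emeasure (lborel \<Otimes>\<^sub>M lborel) (Bad n)
        \<le> ennreal (1/(3*C)) * ennreal C + ennreal (1/(3*\<eta>)) * ennreal \<eta>"
      using int_en n by (intro add_mono mult_left_mono) (auto intro: ennreal_leI)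
    also have "\<dots> = ennreal (2/3)" using C \<eta> by (simp add: ennreal_mult[symmetric] flip: ennreal_plus)
    finally show False by (simp flip: ennreal_1)
  qed
  then obtain m where m: "m \<in> {0..1}" "en m < 3 * C" "emeasure lborel (Pair m -` Bad n) < ennreal (3 * \<eta>)"
    by blast
  have "sum w T \<le> sqrt (2 * real R * (\<epsilon> * (3 * C))) + sqrt (3 * \<eta> * (N0 * (3 * C)))"
  proof (rule mass_le_good_bad_strips[where n = n and h = h and m = m and Z = "Pair m -` Bad n"])
    fix c assume c: "c \<in> {-real R..real R} - Pair m -` Bad n"
    then obtain G where G: "G \<in> fam n" "(m, c) \<notin> unc n G" using m(1) unfolding Bad_def by auto
    then have "cell_cover G {x\<in>T. \<bar>proj m x - c\<bar> < (1/2)^n}"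
      using T(2) unfolding unc_def cell_cover_def by auto
    then show "\<exists>G. finite G \<and> (\<forall>(k, q)\<in>G. k \<le> n) \<and> (\<Sum>(k, q)\<in>G. h^k) \<le> \<epsilon> \<and> cell_cover G {x\<in>T. \<bar>proj m x - c\<bar> < (1/2)^n}"
      using G(1) unfolding fam_def by (intro exI[of _ G]) auto
  next
    show "Pair m -` Bad n \<in> sets borel" using sets_Pair1[OF Bad_sets', of m] by simp
  qed (use T w h m R cardT \<epsilon> \<eta> in \<open>auto simp: en_def intro: less_imp_le\<close>)
  also have "2 * real R * (\<epsilon> * (3 * C)) = \<kappa>\<^sup>2 / 8" using R1 C by (simp add: \<epsilon>_def field_simps)
  also have "3 * \<eta> * (N0 * (3 * C)) = \<kappa>\<^sup>2 / 8" using N0 C by (simp add: \<eta>_def field_simps)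
  also have "sqrt (\<kappa>\<^sup>2 / 8) + sqrt (\<kappa>\<^sup>2 / 8) < \<kappa>"
  proof -
    have "sqrt (\<kappa>\<^sup>2 / 8) < \<kappa> / 2"
      using \<kappa>(1) by (intro real_less_lsqrt) (auto simp: power_divide)
    then show ?thesis by simp
  qed
  finally show False using mass by simp
qed

section \<open>Hausdorff dimension\<close>

text \<open>Ensures that the infimum defining the dimension is not taken over the empty set.\<close>
lemma hnull_3_of_bounded:
  fixes A :: "(real \<times> real) set"
  assumes A: "bounded A"
  shows "hnull 3 A"
proof (rule ccontr)
  assume N: "\<not> hnull 3 A"
  obtain \<kappa> where \<kappa>: "\<kappa> > 0" "\<And>G. finite G \<Longrightarrow> cell_cover G A \<Longrightarrow> \<kappa> \<le> (\<Sum>(k, q)\<in>G. ((2::real) powr - 3)^k)"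
    using dyadic_content_pos[OF N] by auto
  obtain b where b: "\<And>p. p \<in> A \<Longrightarrow> norm p \<le> b" using A bounded_iff by blast
  define M where "M = nat \<lceil>b\<rceil> + 1"
  have le: "\<kappa> \<le> 16 * (real M)\<^sup>2 * (1/2)^k" for k
  proof -
    define I where "I = {- (int M * 2^k) .. int M * 2^k - 1}"
    have cell_mem: "\<lfloor>2^k * z\<rfloor> \<in> I" if "\<bar>z\<bar> \<le> b" for z
    proof -
      have "\<bar>z\<bar> < real M" using that unfolding M_def by linarith
      then have "2^k * \<bar>z\<bar> < 2^k * real M" by simp
      then have "\<bar>2^k * z\<bar> < real_of_int (int M * 2^k)" by (simp add: abs_mult mult.commute)
      then show ?thesis unfolding I_def by (simp only: atLeastAtMost_iff) linarith
    qed
    \<comment> \<open>Of order \<open>4^k\<close> cells at cost \<open>8^-k\<close> each, so the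
      total tends to 0.\<close>
    have "cell_cover (Pair k ` (I \<times> I)) A"
      unfolding cell_cover_def
    proof
      fix p assume "p \<in> A"
      then have "\<bar>fst p\<bar> \<le> b" "\<bar>snd p\<bar> \<le> b"
        using b[of p] norm_fst_le[of "fst p" "snd p"] norm_snd_le[of "snd p" "fst p"] by auto
      then have "cell k p \<in> I \<times> I" unfolding cell_def using cell_mem by simp
      then show "\<exists>(k', q)\<in>Pair k ` (I \<times> I). cell k' p = q" by blast
    qed
    then have "\<kappa> \<le> (\<Sum>(k, q)\<in>Pair k ` (I \<times> I). ((2::real) powr - 3)^k)"
      by (intro \<kappa>(2)) (auto simp: I_def)
    also have "\<dots> = real (card (I \<times> I)) * ((2::real) powr - 3)^k"
      by (subst sum.reindex) (auto simp: inj_on_def)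
    also have "real (card (I \<times> I)) = (2 * real M * 2^k)\<^sup>2"
    proof -
      have "int (card I) = 2 * (int M * 2^k)" unfolding I_def by simp
      then have "real_of_int (int (card I)) = real_of_int (2 * (int M * 2^k))" by (rule arg_cong)
      then show ?thesis by (simp add: card_cartesian_product power2_eq_square)
    qed
    also have "(2 * real M * 2^k)\<^sup>2 * ((2::real) powr - 3)^k = 4 * (real M)\<^sup>2 * (1/2)^k"
    proof -
      have e: "(2::real) powr - 3 = 1/8" by (simp add: powr_minus_divide)
      have "(2 * real M * 2^k)\<^sup>2 * (1/8)^k = 4 * (real M)\<^sup>2 * ((2^k)\<^sup>2 * (1/8)^k)"
        by (simp add: power_mult_distrib)
      also have "((2::real)^k)\<^sup>2 * (1/8)^k = (1/2)^k"
        by (simp add: power_mult[symmetric] mult.commute[of k] power_mult power_mult_distrib[symmetric])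
      finally show ?thesis unfolding e .
    qed
    also have "\<dots> \<le> 16 * (real M)\<^sup>2 * (1/2)^k" by (intro mult_right_mono) auto
    finally show ?thesis .
  qed
  have "(\<lambda>k. 16 * (real M)\<^sup>2 * (1/2)^k) \<longlonglongrightarrow> 16 * (real M)\<^sup>2 * 0"
    by (intro tendsto_mult_left LIMSEQ_realpow_zero) auto
  then have "\<kappa> \<le> 16 * (real M)\<^sup>2 * 0" using le by (intro LIMSEQ_le_const) auto
  then show False using \<kappa>(1) by simp
qed

text \<open>The infimum defining the dimension admits exponent 0, which \<open>hnull\<close> does
  not describe. There every nonempty covering set costs 1.\<close>

lemma hausdorff_measure_0_eq_0D:
  assumes "hausdorff_measure 0 A = 0"
  shows "A = {}"
proof (rule ccontr)
  assume ne: "A \<noteq> {}"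
  have "1 \<le> (\<Sum>i. ennreal (hsize 0 (C i)))" if C: "A \<subseteq> (\<Union>i. C i)" for C :: "nat \<Rightarrow> 'a set"
  proof -
    obtain i where "C i \<noteq> {}" using ne C by blast
    then have "1 = ennreal (hsize 0 (C i))" by (simp add: hsize_def)
    also have "\<dots> \<le> (\<Sum>i. ennreal (hsize 0 (C i)))"
      using sum_le_suminf[of "\<lambda>i. ennreal (hsize 0 (C i))" "{i}"] by simp
    finally show ?thesis .
  qed
  then have "1 \<le> hausdorff_pre 0 1 A" unfolding hausdorff_pre_def by (intro INF_greatest) blast
  also have "\<dots> \<le> hausdorff_measure 0 A"
    unfolding hausdorff_measure_def by (rule SUP_upper) simp
  finally show False using assms by simp
qed

lemma hnull_above_dim:
  fixes A :: "(real \<times> real) set"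
  assumes A: "bounded A" and v: "v > hausdorff_dim A" "v > 0"
  shows "hnull v A"
proof -
  let ?S = "{s. s \<ge> 0 \<and> hausdorff_measure s A = 0}"
  have "3 \<in> ?S" using hnull_3_of_bounded[OF A] hausdorff_measure_eq_0_iff_hnull[of 3 A] by simp
  then have "?S \<noteq> {}" by blast
  moreover have "Inf ?S < v" using v(1) unfolding hausdorff_dim_def .
  ultimately have "\<exists>w\<in>?S. w < v" by (rule cInf_lessD)
  then obtain w where w: "w \<ge> 0" "hausdorff_measure w A = 0" "w < v" by blast
  show ?thesis
  proof (cases "w = 0")
    case True
    then have "A = {}" using w(2) hausdorff_measure_0_eq_0D by blast
    then show ?thesis using hnull_empty by blast
  next
    case False
    then show ?thesis using w hausdorff_measure_eq_0_iff_hnull[of w A] hnull_mono_exponent[of w A v] by auto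
  qed
qed

lemma not_hnull_below_dim:
  assumes "0 < t" "t < hausdorff_dim A"
  shows "\<not> hnull t A"
proof
  assume "hnull t A"
  then have "hausdorff_dim A \<le> t"
    unfolding hausdorff_dim_def using assms hausdorff_measure_eq_0_iff_hnull[of t A]
    by (intro cInf_lower bdd_belowI[of _ 0]) auto
  then show False using assms by simp
qed

lemma hausdorff_dim_eqI:
  fixes A :: "'a::metric_space set"
  assumes d: "d > 0" and above: "\<And>v. v > d \<Longrightarrow> hnull v A" and below: "\<And>u. 0 < u \<Longrightarrow> u < d \<Longrightarrow> \<not> hnull u A"
  shows "hausdorff_dim A = d"
  unfolding hausdorff_dim_def
proof (rule cInf_eq_non_empty)
  let ?S = "{s. s \<ge> 0 \<and> hausdorff_measure s A = 0}"
  have S: "v \<in> ?S" if "v > d" for v using above[OF that] d that hausdorff_measure_eq_0_iff_hnull[of v A] by auto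
  show "?S \<noteq> {}" using S[of "d + 1"] by auto
  fix x assume x: "x \<in> ?S"
  show "d \<le> x"
  proof (rule ccontr)
    assume "\<not> d \<le> x"
    moreover have "x \<noteq> 0"
    proof
      assume "x = 0"
      then have "A = {}" using x hausdorff_measure_0_eq_0D by auto
      then show False using below[of "d/2"] hnull_empty d by auto
    qed
    ultimately show False using below[of x] x hausdorff_measure_eq_0_iff_hnull[of x A] by auto
  qed
next
  let ?S = "{s. s \<ge> 0 \<and> hausdorff_measure s A = 0}"
  fix y assume y: "\<And>x. x \<in> ?S \<Longrightarrow> y \<le> x"
  show "y \<le> d"
  proof (rule field_le_epsilon)
    fix e :: real assume "e > 0"
    then show "y \<le> d + e"
      using above[of "d + e"] d hausdorff_measure_eq_0_iff_hnull[of "d + e" A] by (intro y) auto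
  qed
qed

text \<open>The intercepts of large sections are not contained in a null set, while the upper bound
  fails only on one, so some intercept satisfies both. Countably many exponents decreasing to
  \<open>s - 1\<close> let a single null set serve all \<open>v\<close>.\<close>

lemma exists_dimensional_line_section:
  fixes A :: "(real \<times> real) set"
  assumes A: "compact A" and s: "s > 1" and above: "\<And>v. v > s \<Longrightarrow> hnull v A"
    and below: "\<not> hnull t A" "t > 1" and u: "0 < u" "u < t - 1"
  obtains m c where "m \<in> {0..1}" "\<not> hnull u (A \<inter> line m c)" "\<And>v. v > s - 1 \<Longrightarrow> hnull v (A \<inter> line m c)"
proof -
  obtain m where m: "m \<in> {0..1}" "\<not> (AE c in lborel. hnull u (A \<inter> line m c))"
    using line_section_not_null[OF A below u] by blast
  have pos: "1 / real (Suc j) > 0" for j by simp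
  have "AE c in lborel. hnull (s + 1 / real (Suc j) - 1) (A \<inter> line m c)" for j
    using s pos[of j] by (intro AE_hnull_line_section above m) linarith+
  then have AE: "AE c in lborel. \<forall>j. hnull (s + 1 / real (Suc j) - 1) (A \<inter> line m c)"
    unfolding AE_all_countable by blast
  have "\<exists>c. (\<forall>j. hnull (s + 1 / real (Suc j) - 1) (A \<inter> line m c)) \<and> \<not> hnull u (A \<inter> line m c)"
  proof (rule ccontr)
    assume "\<not> ?thesis"
    then have "AE c in lborel. hnull u (A \<inter> line m c)" using AE by (auto elim!: eventually_mono)
    then show False using m(2) by simp
  qed
  then obtain c where c: "\<And>j. hnull (s + 1 / real (Suc j) - 1) (A \<inter> line m c)" "\<not> hnull u (A \<inter> line m c)"
    by blast
  have "hnull v (A \<inter> line m c)" if v: "v > s - 1" for v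
  proof -
    obtain j where "1 / real (Suc j) < v - (s - 1)" using v reals_Archimedean[of "v - (s - 1)"] by (auto simp: inverse_eq_divide)
    then show ?thesis using s pos[of j] by (intro hnull_mono_exponent[OF c(1)[of j]]) linarith+
  qed
  then show thesis using that m(1) c(2) by blast
qed

section \<open>Pieces of the graph near a regular point\<close>

lemma lipschitz_on_affine_piece:
  assumes "F \<subseteq> {x. f x - m * x = c}" "m \<in> {0..1}" "x \<in> F" "y \<in> F"
  shows "\<bar>f x - f y\<bar> \<le> \<bar>x - (y::real)\<bar>"
proof -
  have "f x - m * x = c" "f y - m * y = c" using assms by blast+
  then have "f x - f y = m * (x - y)" by (simp add: algebra_simps)
  then show ?thesis using assms by (simp add: abs_mult mult_left_le_one_le)
qed

text \<open>The cone omits \<open>x0\<close>, so closed annuli exhaust its part of the graph and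
  countable stability leaves one of them non-null. The positive inner radius \<open>a\<close> makes
  room for later pieces closer to \<open>x0\<close>.\<close>

lemma exists_annulus_piece:
  fixes K :: "real set" and f :: "real \<Rightarrow> real"
  assumes K: "compact K" "continuous_on K f" and s: "s > 1" and dim: "hausdorff_dim (graph f K) = s"
    and reg: "regular_fd_point K f \<beta> x0" and r: "r > 0" and u: "0 < u" "u < s - 1"
  obtains a F where "0 < a" "compact F" "F \<subseteq> {x\<in>K. a \<le> \<bar>x - x0\<bar> \<and> \<bar>x - x0\<bar> < r \<and> \<bar>f x - f x0\<bar> \<le> \<beta> * \<bar>x - x0\<bar>}"
    "\<And>x y. x \<in> F \<Longrightarrow> y \<in> F \<Longrightarrow> \<bar>f x - f y\<bar> \<le> \<bar>x - y\<bar>"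
    "\<not> hnull u F" "\<And>v. v > s - 1 \<Longrightarrow> hnull v F"
proof -
  \<comment> \<open>The midpoint of \<open>u + 1\<close> and \<open>s\<close>: below the dimension,
    yet high enough for sections at exponent \<open>u\<close>.\<close>
  define t where "t = (u + 1 + s) / 2"
  have t: "t > 1" "t < s" "u < t - 1" using u s by (auto simp: t_def field_simps)
  \<comment> \<open>The annuli are closed, for compactness; halving the radius restores the strict
    outer bound.\<close>
  define r' where "r' = r / 2"
  have r': "r' > 0" "r' < r" using r by (auto simp: r'_def)
  define A where "A j = (\<lambda>x. (x, f x)) ` {x\<in>K. r' / real (Suc j) \<le> \<bar>x - x0\<bar> \<and> \<bar>x - x0\<bar> \<le> r' \<and> \<bar>f x - f x0\<bar> \<le> \<beta> * \<bar>x - x0\<bar>}" for j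
  have compact_dom: "compact {x\<in>K. r' / real (Suc j) \<le> \<bar>x - x0\<bar> \<and> \<bar>x - x0\<bar> \<le> r' \<and> \<bar>f x - f x0\<bar> \<le> \<beta> * \<bar>x - x0\<bar>}" for j
  proof -
    have "closed K" using K(1) by (rule compact_imp_closed)
    then have "closed {x\<in>K. \<bar>f x - f x0\<bar> - \<beta> * \<bar>x - x0\<bar> \<le> 0}"
      using K(2) by (intro continuous_on_closed_Collect_le continuous_intros) auto
    moreover have "closed {x. r' / real (Suc j) \<le> \<bar>x - x0\<bar>}" "closed {x. \<bar>x - x0\<bar> \<le> r'}"
      by (intro closed_Collect_le continuous_intros)+
    ultimately have "closed ({x\<in>K. \<bar>f x - f x0\<bar> - \<beta> * \<bar>x - x0\<bar> \<le> 0} \<inter> ({x. r' / real (Suc j) \<le> \<bar>x - x0\<bar>} \<inter> {x. \<bar>x - x0\<bar> \<le> r'}))"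
      by (intro closed_Int)
    then have "compact (K \<inter> ({x\<in>K. \<bar>f x - f x0\<bar> - \<beta> * \<bar>x - x0\<bar> \<le> 0} \<inter> ({x. r' / real (Suc j) \<le> \<bar>x - x0\<bar>} \<inter> {x. \<bar>x - x0\<bar> \<le> r'})))"
      by (rule compact_Int_closed[OF K(1)])
    also have "K \<inter> ({x\<in>K. \<bar>f x - f x0\<bar> - \<beta> * \<bar>x - x0\<bar> \<le> 0} \<inter> ({x. r' / real (Suc j) \<le> \<bar>x - x0\<bar>} \<inter> {x. \<bar>x - x0\<bar> \<le> r'})) =
        {x\<in>K. r' / real (Suc j) \<le> \<bar>x - x0\<bar> \<and> \<bar>x - x0\<bar> \<le> r' \<and> \<bar>f x - f x0\<bar> \<le> \<beta> * \<bar>x - x0\<bar>}"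
      by auto
    finally show ?thesis .
  qed
  have compact_A: "compact (A j)" for j
    unfolding A_def
    by (intro compact_continuous_image compact_dom continuous_intros continuous_on_subset[OF K(2)]) auto
  have "compact ((\<lambda>x. (x, f x)) ` K)" by (intro compact_continuous_image K continuous_intros)
  moreover have graph_eq: "graph f X = (\<lambda>x. (x, f x)) ` X" for X unfolding graph_def by auto
  ultimately have "bounded (graph f K)" by (simp add: compact_imp_bounded)
  then have "hnull v (graph f K)" if "v > s" for v using hnull_above_dim[of "graph f K" v] dim that s by auto
  then have above: "hnull v (A j)" if "v > s" for v j
    by (rule hnull_subset[OF _ _]) (use that in \<open>auto simp: A_def graph_eq\<close>)
  have "\<exists>j. \<not> hnull t (A j)"
  proof (rule ccontr)
    assume "\<not> ?thesis"
    then have "hnull t (\<Union>j. A j)" by (intro hnull_UN) blast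
    moreover have "cone_V f x0 \<beta> \<inter> graph f (K \<inter> ball x0 r') \<subseteq> (\<Union>j. A j)"
    proof
      fix p assume p: "p \<in> cone_V f x0 \<beta> \<inter> graph f (K \<inter> ball x0 r')"
      then obtain x where x: "p = (x, f x)" "x \<in> K" "dist x0 x < r'" "x \<noteq> x0" "\<bar>(f x - f x0) / (x - x0)\<bar> \<le> \<beta>"
        unfolding graph_def cone_V_def by auto
      have cone: "\<bar>f x - f x0\<bar> \<le> \<beta> * \<bar>x - x0\<bar>" using x(4,5) by (simp add: abs_divide field_simps)
      have "\<bar>x - x0\<bar> / r' > 0" using x(4) r' by simp
      then obtain j where "inverse (real (Suc j)) < \<bar>x - x0\<bar> / r'" using reals_Archimedean by blast
      then have "r' / real (Suc j) \<le> \<bar>x - x0\<bar>" using r' by (simp add: field_simps)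
      moreover have "\<bar>x - x0\<bar> \<le> r'" using x(3) by (simp add: dist_real_def abs_minus_commute)
      ultimately have "p \<in> A j" unfolding A_def x(1) using x(2) cone by (intro imageI) simp
      then show "p \<in> (\<Union>j. A j)" by blast
    qed
    ultimately have "hnull t (cone_V f x0 \<beta> \<inter> graph f (K \<inter> ball x0 r'))" by (rule hnull_subset)
    moreover have "hausdorff_dim (cone_V f x0 \<beta> \<inter> graph f (K \<inter> ball x0 r')) = s"
      using reg r'(1) dim unfolding regular_fd_point_def by simp
    ultimately show False using not_hnull_below_dim t by (metis less_trans zero_less_one)
  qed
  then obtain j where j: "\<not> hnull t (A j)" by blast
  obtain m c where mc: "m \<in> {0..1}" "\<not> hnull u (A j \<inter> line m c)" "\<And>v. v > s - 1 \<Longrightarrow> hnull v (A j \<inter> line m c)"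
    using exists_dimensional_line_section[OF compact_A s above j t(1) u(1) t(3)] by metis
  define F where "F = fst ` (A j \<inter> line m c)"
  have closed_line: "closed (line m c)"
    unfolding line_def by (intro closed_Collect_eq continuous_on_proj continuous_on_const)
  have F_iff: "x \<in> F \<longleftrightarrow> (x, f x) \<in> A j \<and> f x - m * x = c" for x
    unfolding F_def A_def line_def proj_def by force
  have lip: "\<bar>f x - f y\<bar> \<le> \<bar>x - y\<bar>" if "x \<in> F" "y \<in> F" for x y
    by (rule lipschitz_on_affine_piece[of F f m c]) (use that mc(1) F_iff in auto)
  show thesis
  proof (rule that[of "r' / real (Suc j)" F])
    show "0 < r' / real (Suc j)" using r' by simp
    show "compact F" unfolding F_def
      by (intro compact_continuous_image continuous_intros compact_Int_closed compact_A closed_line)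
    show "F \<subseteq> {x\<in>K. r' / real (Suc j) \<le> \<bar>x - x0\<bar> \<and> \<bar>x - x0\<bar> < r \<and> \<bar>f x - f x0\<bar> \<le> \<beta> * \<bar>x - x0\<bar>}"
      using r' unfolding F_def A_def by fastforce
    show "\<bar>f x - f y\<bar> \<le> \<bar>x - y\<bar>" if "x \<in> F" "y \<in> F" for x y using lip that .
    show "\<not> hnull u F"
    proof
      assume N: "hnull u F"
      \<comment> \<open>Over \<open>F\<close> the graph map and \<open>fst\<close> are mutually
        inverse Lipschitz maps, so nullity passes both ways between the section and its
        projection.\<close>
      have "2-lipschitz_on F (\<lambda>x. (x, f x))"
      proof (rule lipschitz_onI)
        fix x y assume xy: "x \<in> F" "y \<in> F"
        have "dist (x, f x) (y, f y) \<le> 2 * sup_dist (x, f x) (y, f y)" by (rule dist_le_2_sup_dist)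
        also have "sup_dist (x, f x) (y, f y) = \<bar>x - y\<bar>" using lip[OF xy] by (simp add: sup_dist_def)
        finally show "dist (x, f x) (y, f y) \<le> 2 * dist x y" by (simp add: dist_real_def)
      qed simp
      then have "hnull u ((\<lambda>x. (x, f x)) ` F)" using N u(1) by (intro hnull_lipschitz_image)
      moreover have "A j \<inter> line m c \<subseteq> (\<lambda>x. (x, f x)) ` F" unfolding F_def A_def by force
      ultimately show False using mc(2) hnull_subset by blast
    qed
    show "hnull v F" if "v > s - 1" for v
    proof -
      have "1-lipschitz_on (A j \<inter> line m c) fst" by (rule lipschitz_onI) (auto simp: dist_fst_le)
      then show ?thesis unfolding F_def using mc(3)[OF that] that s by (intro hnull_lipschitz_image) auto
    qed
  qed
qed

section \<open>Gluing the pieces at the regular point\<close>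

theorem theorem3p7:
  fixes s :: real and K :: "real set" and f :: "real \<Rightarrow> real"
  assumes "1 < s" "s \<le> 2"
    and "compact K" "K \<subseteq> {0..1}"
    and "continuous_on K f"
    and "hausdorff_dim (graph f K) = s"
    and "regular_full_dimensional K f"
  shows "\<exists>F. compact F \<and> F \<subseteq> K \<and> hausdorff_dim F = s - 1 \<and> (\<exists>L. L-lipschitz_on F f)"
proof -
  obtain \<beta> x0 where \<beta>: "\<beta> > 0" and reg: "regular_fd_point K f \<beta> x0"
    using assms(7) unfolding regular_full_dimensional_def by blast
  have x0: "x0 \<in> K" using reg unfolding regular_fd_point_def by blast
  \<comment> \<open>Choosing each piece at most half as far from \<open>x0\<close> as the previous ones makes distances
    between different pieces comparable to the distances from \<open>x0\<close>.\<close>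
  define u where "u n = (s - 1) * (1 - 1 / real (n + 2))" for n :: nat
  have u: "0 < u n" "u n < s - 1" for n
  proof -
    have "1 - 1 / real (n + 2) > 0" by (simp add: field_simps)
    then show "0 < u n" unfolding u_def using assms(1) by simp
    have "(s - 1) * (1 - 1 / real (n + 2)) < (s - 1) * 1"
      using assms(1) by (intro mult_strict_left_mono) auto
    then show "u n < s - 1" unfolding u_def by simp
  qed
  define piece where "piece n r a F \<longleftrightarrow> 0 < a \<and> compact F \<and>
      F \<subseteq> {x\<in>K. a \<le> \<bar>x - x0\<bar> \<and> \<bar>x - x0\<bar> < r \<and> \<bar>f x - f x0\<bar> \<le> \<beta> * \<bar>x - x0\<bar>} \<and>
      (\<forall>x\<in>F. \<forall>y\<in>F. \<bar>f x - f y\<bar> \<le> \<bar>x - y\<bar>) \<and> \<not> hnull (u n) F \<and> (\<forall>v>s - 1. hnull v F)" for n r a F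
  have ex_piece: "\<exists>a F. piece n r a F" if r: "r > 0" for n r
    by (rule exists_annulus_piece[OF assms(3,5,1,6) reg r u(1)[of n] u(2)[of n]])
       (intro exI, unfold piece_def, blast)
  \<comment> \<open>Each pair holds an inner radius and a piece. The starting pair carries no real
    piece, hence the shift to \<open>Suc n\<close> in \<open>F\<close>. The bound
    \<open>(1/2)^n\<close> makes the pieces converge to \<open>x0\<close> at an explicit
    rate.\<close>
  obtain q :: "nat \<Rightarrow> real \<times> real set" where q: "\<And>n. 0 < fst (q n)"
    "\<And>n. piece (Suc n) (min (fst (q n) / 2) ((1/2)^n)) (fst (q (Suc n))) (snd (q (Suc n)))"
  proof -
    have "\<exists>q :: nat \<Rightarrow> real \<times> real set. \<forall>n. 0 < fst (q n) \<and>
        piece (Suc n) (min (fst (q n) / 2) ((1/2)^n)) (fst (q (Suc n))) (snd (q (Suc n)))"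
    proof (rule dependent_nat_choice)
      show "\<exists>x::real \<times> real set. 0 < fst x" by (intro exI[of _ "(1, {})"]) simp
      fix x :: "real \<times> real set" and n assume "0 < fst x"
      then have "min (fst x / 2) ((1/2)^n) > 0" by simp
      then obtain a F where "piece (Suc n) (min (fst x / 2) ((1/2)^n)) a F" using ex_piece by blast
      then show "\<exists>y. 0 < fst y \<and> piece (Suc n) (min (fst x / 2) ((1/2)^n)) (fst y) (snd y)"
        by (intro exI[of _ "(a, F)"]) (simp add: piece_def)
    qed
    then show thesis using that by blast
  qed
  define a where "a n = fst (q n)" for n
  define F where "F n = snd (q (Suc n))" for n
  have F: "compact (F n)" "\<And>x. x \<in> F n \<Longrightarrow> x \<in> K" "\<And>x. x \<in> F n \<Longrightarrow> a (Suc n) \<le> \<bar>x - x0\<bar>"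
    "\<And>x. x \<in> F n \<Longrightarrow> \<bar>x - x0\<bar> < a n / 2" "\<And>x. x \<in> F n \<Longrightarrow> \<bar>x - x0\<bar> < (1/2)^n"
    "\<And>x. x \<in> F n \<Longrightarrow> \<bar>f x - f x0\<bar> \<le> \<beta> * \<bar>x - x0\<bar>"
    "\<And>x y. x \<in> F n \<Longrightarrow> y \<in> F n \<Longrightarrow> \<bar>f x - f y\<bar> \<le> \<bar>x - y\<bar>"
    "\<not> hnull (u (Suc n)) (F n)" "\<And>v. v > s - 1 \<Longrightarrow> hnull v (F n)" for n
    using q(2)[of n] unfolding piece_def F_def a_def by auto
  have a_pos: "a n > 0" for n unfolding a_def by (rule q(1))
  have a_half: "a (Suc n) \<le> a n" for n
  proof -
    \<comment> \<open>Successive radii are compared through a point of the piece, which exists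
      because the piece is not null.\<close>
    have "F n \<noteq> {}" using F(8)[of n] hnull_empty by metis
    then obtain x where "x \<in> F n" by blast
    then show ?thesis using F(3,4)[of x n] a_pos[of n] by linarith
  qed
  have a_mono: "a j \<le> a i" if "i \<le> j" for i j
    using a_half that by (rule lift_Suc_antimono_le)
  define E where "E = insert x0 (\<Union>n. F n)"
  have EK: "E \<subseteq> K" unfolding E_def using x0 F(2) by blast
  have far: "2 * \<bar>y - x0\<bar> \<le> \<bar>x - x0\<bar>" if "x \<in> F i" "y \<in> F j" "i < j" for x y i j
  proof -
    have "a j \<le> a (Suc i)" using that(3) by (intro a_mono) simp
    moreover have "2 * \<bar>y - x0\<bar> \<le> a j" using F(4)[OF that(2)] by simp
    ultimately show ?thesis using F(3)[OF that(1)] by (meson order_trans)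
  qed
  have compact_E: "compact E"
  proof -
    \<comment> \<open>Outside any ball around \<open>x0\<close> only finitely many pieces remain,
      which exhibits \<open>E\<close> as an intersection of closed sets.\<close>
    have "E = (\<Inter>N. cball x0 ((1/2)^N) \<union> (\<Union>n<N. F n))"
    proof (intro subset_antisym subsetI)
      fix x assume x: "x \<in> E"
      show "x \<in> (\<Inter>N. cball x0 ((1/2)^N) \<union> (\<Union>n<N. F n))"
      proof
        fix N :: nat
        show "x \<in> cball x0 ((1/2)^N) \<union> (\<Union>n<N. F n)"
        proof (cases "x = x0")
          case False
          then obtain n where n: "x \<in> F n" using x unfolding E_def by blast
          show ?thesis
          proof (cases "n < N")
            case True
            then show ?thesis using n by blast
          next
            case False
            then have "(1/2::real)^n \<le> (1/2)^N" by (intro power_decreasing) simp_all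
            then have "\<bar>x - x0\<bar> \<le> (1/2)^N" using F(5)[OF n] by linarith
            then show ?thesis by (simp add: dist_real_def abs_minus_commute)
          qed
        qed simp
      qed
    next
      fix x assume x: "x \<in> (\<Inter>N. cball x0 ((1/2)^N) \<union> (\<Union>n<N. F n))"
      show "x \<in> E"
      proof (rule ccontr)
        assume nE: "x \<notin> E"
        then have "dist x0 x > 0" unfolding E_def by auto
        then obtain N where N: "(1/2::real)^N < dist x0 x" using real_arch_pow_inv[of "dist x0 x" "1/2"] by auto
        have "x \<in> cball x0 ((1/2)^N)" using x nE unfolding E_def by blast
        then have "dist x0 x \<le> (1/2)^N" by (simp only: mem_cball)
        then show False using N by linarith
      qed
    qed
    also have "closed \<dots>"
      by (intro closed_INT ballI closed_Un closed_cball closed_UN finite_lessThan compact_imp_closed F(1))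
    finally have "closed E" .
    moreover have "bounded E" using bounded_subset[OF compact_imp_bounded[OF assms(3)] EK] .
    ultimately show ?thesis by (simp add: compact_eq_bounded_closed)
  qed
  have cross: "\<bar>f x - f y\<bar> \<le> (3 * \<beta> + 1) * \<bar>x - y\<bar>" if "x \<in> F i" "y \<in> F j" "i < j" for x y i j
  proof -
    have "\<bar>f x - f y\<bar> \<le> \<beta> * \<bar>x - x0\<bar> + \<beta> * \<bar>y - x0\<bar>" using F(6)[OF that(1)] F(6)[OF that(2)] by linarith
    also have "\<dots> = \<beta> * (\<bar>x - x0\<bar> + \<bar>y - x0\<bar>)" by (simp add: algebra_simps)
    \<comment> \<open>As \<open>y\<close> is at most half as far from \<open>x0\<close> as
      \<open>x\<close>, the distances of \<open>x\<close> and \<open>y\<close> from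
      \<open>x0\<close> are at most twice and once the distance between them.\<close>
    also have "\<dots> \<le> \<beta> * (3 * \<bar>x - y\<bar>)"
    proof (rule mult_left_mono)
      have "\<bar>x - x0\<bar> \<le> \<bar>x - y\<bar> + \<bar>y - x0\<bar>" by linarith
      then show "\<bar>x - x0\<bar> + \<bar>y - x0\<bar> \<le> 3 * \<bar>x - y\<bar>"
        using far[OF that] by (simp del: abs_triangle_ineq)
    qed (use \<beta> in simp)
    also have "\<dots> \<le> (3 * \<beta> + 1) * \<bar>x - y\<bar>" by (simp add: algebra_simps)
    finally show ?thesis .
  qed
  \<comment> \<open>\<open>3 * \<beta>\<close> serves pairs from different pieces, and the 1 pairs
    within one piece, where the slope is at most 1.\<close>
  have "(3 * \<beta> + 1)-lipschitz_on E f"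
  proof (rule lipschitz_onI)
    have base: "\<bar>f x - f x0\<bar> \<le> (3 * \<beta> + 1) * \<bar>x - x0\<bar>" if "x \<in> F i" for x i
    proof -
      have "\<beta> * \<bar>x - x0\<bar> \<le> (3 * \<beta> + 1) * \<bar>x - x0\<bar>" using \<beta> by (intro mult_right_mono) auto
      then show ?thesis using F(6)[OF that] by linarith
    qed
    have pieces: "\<bar>f x - f y\<bar> \<le> (3 * \<beta> + 1) * \<bar>x - y\<bar>" if xy: "x \<in> F i" "y \<in> F j" for x y i j
    proof (cases i j rule: linorder_cases)
      case less
      then show ?thesis using cross xy by blast
    next
      case equal
      have "1 * \<bar>x - y\<bar> \<le> (3 * \<beta> + 1) * \<bar>x - y\<bar>" using \<beta> by (intro mult_right_mono) auto
      then show ?thesis using F(7)[of x i y] xy equal by simp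
    next
      case greater
      then show ?thesis using cross[OF xy(2,1)] by (simp add: abs_minus_commute)
    qed
    fix x y assume "x \<in> E" "y \<in> E"
    then consider "x = x0" "y = x0" | i where "x \<in> F i" "y = x0" | j where "x = x0" "y \<in> F j" | i j where "x \<in> F i" "y \<in> F j"
      unfolding E_def by blast
    then have "\<bar>f x - f y\<bar> \<le> (3 * \<beta> + 1) * \<bar>x - y\<bar>"
    proof cases
      case 3
      then show ?thesis using base[of y j] by (simp add: abs_minus_commute)
    qed (use base pieces in auto)
    then show "dist (f x) (f y) \<le> (3 * \<beta> + 1) * dist x y" by (simp add: dist_real_def)
  qed (use \<beta> in simp)
  moreover have "hausdorff_dim E = s - 1"
  proof (rule hausdorff_dim_eqI)
    show "s - 1 > 0" using assms(1) by simp
    fix v assume v: "v > s - 1"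
    then have v0: "v > 0" using assms(1) by simp
    have "hnull v {x0}"
      by (rule hnull_of_finite_covers[OF v0], rule exI[of _ "{0::nat}"], rule exI[of _ "\<lambda>_. {x0}"]) (use v0 in simp)
    then have "hnull v (case n of 0 \<Rightarrow> {x0} | Suc i \<Rightarrow> F i)" for n using F(9)[OF v] by (cases n) auto
    then have "hnull v (\<Union>n. case n of 0 \<Rightarrow> {x0} | Suc i \<Rightarrow> F i)" by (rule hnull_UN)
    moreover have "E \<subseteq> (\<Union>n. case n of 0 \<Rightarrow> {x0} | Suc i \<Rightarrow> F i)"
    proof
      fix x assume "x \<in> E"
      then consider "x = x0" | i where "x \<in> F i" unfolding E_def by blast
      then show "x \<in> (\<Union>n. case n of 0 \<Rightarrow> {x0} | Suc i \<Rightarrow> F i)"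
      proof cases
        case 1
        then show ?thesis by (intro UN_I[of 0]) simp_all
      next
        case (2 i)
        then show ?thesis by (intro UN_I[of "Suc i"]) simp_all
      qed
    qed
    ultimately show "hnull v E" by (rule hnull_subset)
  next
    fix w assume w: "0 < w" "w < s - 1"
    show "\<not> hnull w E"
    proof
      assume N: "hnull w E"
      \<comment> \<open>An index with \<open>w \<le> u (Suc n)\<close> is sought, the exponent at
        which \<open>F n\<close> was built to be non-null.\<close>
      have "1 - w / (s - 1) > 0" using w by simp
      then obtain n where "inverse (real (Suc n)) < 1 - w / (s - 1)" using reals_Archimedean by blast
      moreover have "1 / real (Suc n + 2) \<le> inverse (real (Suc n))" by (simp add: field_simps)
      ultimately have "w / (s - 1) < 1 - 1 / real (Suc n + 2)" by linarith
      then have "w \<le> u (Suc n)" using w unfolding u_def by (simp add: field_simps)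
      then have "hnull (u (Suc n)) E" using hnull_mono_exponent[OF N] w by blast
      then show False using F(8)[of n] hnull_subset[of _ E "F n"] unfolding E_def by blast
    qed
  qed
  ultimately show ?thesis using compact_E EK by blast
qed

end
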